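(* The following hold. 1. For every nontrivial finite group $G$, \[ 0\leq\operatorname{endapp}(G)\leq\Big(\frac{1}{\log 2}+\frac{1}{\log|G|}\Big)\log^2|G| \quad\text{and}\quad 1\leq\operatorname{affapp}(G)\leq\Big(\frac{1}{\log 2}+\frac{2}{\log|G|}\Big)\log^2|G|. \] In particular, $\operatorname{endapp}(G)\leq\operatorname{affapp}(G)=O(\log^2|G|)$ as $|G|\to\infty$ (over finite groups $G$). 2. There is an infinite class of (pairwise non-isomorphic) finite groups $H$ with $\operatorname{endapp}(H)\geq\log_2|H|$ and $\operatorname{affapp}(H)\geq\log_2|H|+1$. In particular, $\limsup_{|G|\to\infty}\operatorname{endapp}(G)=\limsup_{|G|\to\infty}\operatorname{affapp}(G)=\infty$, where $G$ ranges over finite groups. 3. There is an infinite class of (pairwise non-isomorphic) finite groups $G$ satisfying $\operatorname{endapp}(G)=0$ and $\operatorname{affapp}(G)=1$. In particular, $\liminf_{|G|\to\infty}\operatorname{endapp}(G)=0$ and $\liminf_{|G|\to\infty}\operatorname{affapp}(G)=1$, where $G$ ranges over finite groups.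
   Context: $\log$ denotes the natural logarithm, $\log_2$ the base $2$ logarithm, and $\log^2 x=(\log x)^2$. A function on a set $M$ means a function $M\to M$. For a group $G$, $\operatorname{End}(G)$ is the set of group endomorphisms of $G$, and $\operatorname{Aff}(G)$ is the set of affine maps on $G$, i.e. the functions $A_{g,\varphi}:G\to G$, $x\mapsto g\varphi(x)$, with $g\in G$ and $\varphi\in\operatorname{End}(G)$. For a finite group $G$ and a function $f:G\to G$, set $\operatorname{endapp}(f):=\max_{\varphi\in\operatorname{End}(G)}|\{x\in G: \varphi(x)=f(x)\}|$ and $\operatorname{affapp}(f):=\max_{A\in\operatorname{Aff}(G)}|\{x\in G: A(x)=f(x)\}|$. Set $\operatorname{endapp}(G):=\min_{f:G\to G}\operatorname{endapp}(f)$ and $\operatorname{affapp}(G):=\min_{f:G\to G}\operatorname{affapp}(f)$. *)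

theory Defs
  imports
    "HOL-Algebra.Elementary_Groups"
    "HOL-Library.Landau_Symbols"
    "HOL-Library.Extended_Real"
begin

(* As for auto in HOL-Algebra.Bij, functions on the carrier are represented by
   extensional functions, so that each map is counted once. *)

definition End :: "('a, 'b) monoid_scheme \<Rightarrow> ('a \<Rightarrow> 'a) set" where
  "End G = hom G G \<inter> extensional (carrier G)"

definition affine_map :: "('a, 'b) monoid_scheme \<Rightarrow> 'a \<Rightarrow> ('a \<Rightarrow> 'a) \<Rightarrow> 'a \<Rightarrow> 'a" where
  "affine_map G g \<phi> = (\<lambda>x\<in>carrier G. g \<otimes>\<^bsub>G\<^esub> \<phi> x)"

definition Aff :: "('a, 'b) monoid_scheme \<Rightarrow> ('a \<Rightarrow> 'a) set" where
  "Aff G = {affine_map G g \<phi> | g \<phi>. g \<in> carrier G \<and> \<phi> \<in> End G}"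

definition agreement :: "('a, 'b) monoid_scheme \<Rightarrow> ('a \<Rightarrow> 'a) \<Rightarrow> ('a \<Rightarrow> 'a) \<Rightarrow> nat" where
  "agreement G h f = card {x \<in> carrier G. h x = f x}"

definition endapp_fun :: "('a, 'b) monoid_scheme \<Rightarrow> ('a \<Rightarrow> 'a) \<Rightarrow> nat" where
  "endapp_fun G f = Max ((\<lambda>\<phi>. agreement G \<phi> f) ` End G)"

definition affapp_fun :: "('a, 'b) monoid_scheme \<Rightarrow> ('a \<Rightarrow> 'a) \<Rightarrow> nat" where
  "affapp_fun G f = Max ((\<lambda>A. agreement G A f) ` Aff G)"

definition endapp :: "('a, 'b) monoid_scheme \<Rightarrow> nat" where
  "endapp G = Min (endapp_fun G ` (carrier G \<rightarrow>\<^sub>E carrier G))"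

definition affapp :: "('a, 'b) monoid_scheme \<Rightarrow> nat" where
  "affapp G = Min (affapp_fun G ` (carrier G \<rightarrow>\<^sub>E carrier G))"

(* The limit |G| \<rightarrow> \<infinity> with G ranging over finite groups with elements in 'a.
   For 'a = nat these are all finite groups up to isomorphism, by the lemma below. *)
definition large_finite_groups :: "('a, 'b) monoid_scheme filter" where
  "large_finite_groups =
     inf (filtercomap order at_top) (principal {G. group G \<and> finite (carrier G)})"

lemma finite_group_iso_nat:
  fixes G :: "('a, 'b) monoid_scheme"
  assumes "group G" and "finite (carrier G)"
  obtains H :: "nat monoid" where "group H" "finite (carrier H)" "G \<cong> H"
proof -
  interpret group G by fact
  obtain h :: "'a \<Rightarrow> nat" where h: "inj_on h (carrier G)"
    using finite_imp_inj_to_nat_seg[OF assms(2)] by auto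
  define k where "k = inv_into (carrier G) h"
  define H :: "nat monoid" where
    "H = \<lparr>carrier = h ` carrier G, mult = (\<lambda>x y. h (k x \<otimes>\<^bsub>G\<^esub> k y)), one = h \<one>\<^bsub>G\<^esub>\<rparr>"
  have kh [simp]: "k (h x) = x" if "x \<in> carrier G" for x
    using that h by (simp add: k_def)
  have "group H"
  proof (rule groupI)
    fix x assume "x \<in> carrier H"
    then obtain a where a: "a \<in> carrier G" "x = h a" by (auto simp: H_def)
    then have "h (inv\<^bsub>G\<^esub> a) \<in> carrier H" "h (inv\<^bsub>G\<^esub> a) \<otimes>\<^bsub>H\<^esub> x = \<one>\<^bsub>H\<^esub>"
      by (auto simp: H_def)
    then show "\<exists>y\<in>carrier H. y \<otimes>\<^bsub>H\<^esub> x = \<one>\<^bsub>H\<^esub>" by blast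
  qed (auto simp: H_def m_assoc)
  moreover have "finite (carrier H)" using assms(2) by (simp add: H_def)
  moreover have "h \<in> iso G H"
    using h by (auto simp: iso_def hom_def H_def bij_betw_def)
  then have "G \<cong> H" by (rule is_isoI)
  ultimately show thesis by (rule that)
qed

end

(* Upper bounds: if every function agrees in at least m points with some member of a finite family F
   of maps on a set of n elements, then n^n <= |F| (n choose m) n^(n-m), hence m! <= |F|. A group of
   order n is generated by at most log2 n elements, so |End G| <= n^(log2 n) and
   |Aff G| <= n^(log2 n + 1); as e^m <= m! for m >= 7, taking logarithms gives the bounds.

   Large values: on an elementary abelian 2-group of rank d, any function is matched on a basis by an
   endomorphism, and on a basis together with the neutral element by an affine map.

   Small values: if no endomorphism maps an element u ~= 1 to its inverse, then x |-> g phi(x) agrees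
   with inversion at most once. Indeed, if it does so at x and y, then phi followed by conjugation
   with x inverts x^-1 y. Such groups are obtained on (Z/3^k)^3 from the product
   x + y + 3^(k-1) [x, y] for an alternating bilinear bracket: powers are multiples and commutators
   are 2 * 3^(k-1) [x, y], so reduction mod 3 turns an endomorphism into an endomorphism of the algebra
   (F_3^3, [ , ]). For the bracket with [e1,e2] = e1, [e2,e3] = e2, [e3,e1] = e3 these are only zero
   and the cyclic shifts of the basis, none of which has the eigenvalue -1. *)
theory Submission
  imports Defs "HOL-Analysis.Harmonic_Numbers" "HOL-Library.Product_Plus"
begin

section \<open>Approximability and isomorphism invariance\<close>

lemma End_subset: "End G \<subseteq> carrier G \<rightarrow>\<^sub>E carrier G"
  by (auto simp: End_def hom_def PiE_def)

lemma (in group) Aff_subset: "Aff G \<subseteq> carrier G \<rightarrow>\<^sub>E carrier G"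
  by (auto simp: Aff_def affine_map_def End_def hom_def Pi_iff)

lemma finite_End: "finite (carrier G) \<Longrightarrow> finite (End G)"
  by (rule finite_subset[OF End_subset]) (simp add: finite_PiE)

lemma (in group) finite_Aff: "finite (carrier G) \<Longrightarrow> finite (Aff G)"
  by (rule finite_subset[OF Aff_subset]) (simp add: finite_PiE)

lemma restrict_hom_in_End:
  assumes "group G" "\<phi> \<in> hom G G"
  shows "restrict \<phi> (carrier G) \<in> End G"
proof -
  interpret group G by fact
  show ?thesis using assms(2) by (auto simp: End_def hom_def)
qed

lemma (in group) const_one_in_hom: "(\<lambda>_. \<one>) \<in> hom G G"
  by (auto simp: hom_def)

text \<open>\<open>Min\<close> and \<open>Max\<close> range over finite nonempty sets here, so the
  bound unfolds into quantifiers. Agreement looks only at the carrier, so extensional functions may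
  be replaced by arbitrary ones, which avoids restrictions in the constructions below.\<close>

lemma endapp_le_iff:
  assumes "group G" "finite (carrier G)"
  shows "endapp G \<le> k \<longleftrightarrow>
    (\<exists>f\<in>carrier G \<rightarrow> carrier G. \<forall>\<phi>\<in>hom G G. card {x\<in>carrier G. \<phi> x = f x} \<le> k)"
proof -
  interpret group G by fact
  have ne: "End G \<noteq> {}"
    using restrict_hom_in_End[OF assms(1) const_one_in_hom] by auto
  have ne2: "(carrier G \<rightarrow>\<^sub>E carrier G) \<noteq> {}"
    using ne End_subset[of G] by auto
  have fin: "finite (carrier G \<rightarrow>\<^sub>E carrier G)"
    using assms(2) by (simp add: finite_PiE)
  have "endapp G \<le> k \<longleftrightarrow>
     (\<exists>f\<in>carrier G \<rightarrow>\<^sub>E carrier G. \<forall>\<phi>\<in>End G. agreement G \<phi> f \<le> k)"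
    using ne ne2 fin finite_End[OF assms(2)]
    by (simp add: endapp_def endapp_fun_def Min_le_iff)
  also have "\<dots> \<longleftrightarrow>
    (\<exists>f\<in>carrier G \<rightarrow> carrier G. \<forall>\<phi>\<in>hom G G. card {x\<in>carrier G. \<phi> x = f x} \<le> k)"
    (is "?L \<longleftrightarrow> ?R")
  proof
    assume ?L
    then obtain f where f: "f \<in> carrier G \<rightarrow>\<^sub>E carrier G" "\<forall>\<phi>\<in>End G. agreement G \<phi> f \<le> k" by auto
    have "card {x\<in>carrier G. \<phi> x = f x} \<le> k" if "\<phi> \<in> hom G G" for \<phi>
    proof -
      have "agreement G (restrict \<phi> (carrier G)) f = card {x\<in>carrier G. \<phi> x = f x}"
        unfolding agreement_def by (rule arg_cong[where f = card]) auto
      then show ?thesis using f(2) restrict_hom_in_End[OF assms(1) that] by metis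
    qed
    then show ?R using f by (intro bexI[of _ f]) auto
  next
    assume ?R
    then obtain f where f: "f \<in> carrier G \<rightarrow> carrier G"
      "\<forall>\<phi>\<in>hom G G. card {x\<in>carrier G. \<phi> x = f x} \<le> k" by auto
    have "agreement G \<phi> (restrict f (carrier G)) \<le> k" if "\<phi> \<in> End G" for \<phi>
    proof -
      have "agreement G \<phi> (restrict f (carrier G)) = card {x\<in>carrier G. \<phi> x = f x}"
        unfolding agreement_def by (rule arg_cong[where f = card]) auto
      then show ?thesis using f(2) that by (auto simp: End_def)
    qed
    then show ?L using f by (intro bexI[of _ "restrict f (carrier G)"]) auto
  qed
  finally show ?thesis .
qed

lemma affapp_le_iff:
  assumes "group G" "finite (carrier G)"
  shows "affapp G \<le> k \<longleftrightarrow>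
    (\<exists>f\<in>carrier G \<rightarrow> carrier G. \<forall>g\<in>carrier G. \<forall>\<phi>\<in>hom G G.
       card {x\<in>carrier G. g \<otimes>\<^bsub>G\<^esub> \<phi> x = f x} \<le> k)"
proof -
  interpret group G by fact
  have ne: "Aff G \<noteq> {}"
    using restrict_hom_in_End[OF assms(1) const_one_in_hom] by (auto simp: Aff_def)
  have ne2: "(carrier G \<rightarrow>\<^sub>E carrier G) \<noteq> {}"
    using ne Aff_subset by auto
  have fin: "finite (carrier G \<rightarrow>\<^sub>E carrier G)"
    using assms(2) by (simp add: finite_PiE)
  have "affapp G \<le> k \<longleftrightarrow>
     (\<exists>f\<in>carrier G \<rightarrow>\<^sub>E carrier G. \<forall>A\<in>Aff G. agreement G A f \<le> k)"
    using ne ne2 fin finite_Aff[OF assms(2)]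
    by (simp add: affapp_def affapp_fun_def Min_le_iff)
  also have "\<dots> \<longleftrightarrow>
    (\<exists>f\<in>carrier G \<rightarrow> carrier G. \<forall>g\<in>carrier G. \<forall>\<phi>\<in>hom G G.
       card {x\<in>carrier G. g \<otimes>\<^bsub>G\<^esub> \<phi> x = f x} \<le> k)"
    (is "?L \<longleftrightarrow> ?R")
  proof
    assume ?L
    then obtain f where f: "f \<in> carrier G \<rightarrow>\<^sub>E carrier G" "\<forall>A\<in>Aff G. agreement G A f \<le> k" by auto
    have "card {x\<in>carrier G. g \<otimes>\<^bsub>G\<^esub> \<phi> x = f x} \<le> k"
      if "g \<in> carrier G" "\<phi> \<in> hom G G" for g \<phi>
    proof -
      have "agreement G (affine_map G g (restrict \<phi> (carrier G))) f
          = card {x\<in>carrier G. g \<otimes>\<^bsub>G\<^esub> \<phi> x = f x}"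
        unfolding agreement_def affine_map_def by (rule arg_cong[where f = card]) auto
      moreover have "affine_map G g (restrict \<phi> (carrier G)) \<in> Aff G"
        using that(1) restrict_hom_in_End[OF assms(1) that(2)] by (auto simp: Aff_def)
      ultimately show ?thesis using f(2) by metis
    qed
    then show ?R using f by (intro bexI[of _ f]) auto
  next
    assume ?R
    then obtain f where f: "f \<in> carrier G \<rightarrow> carrier G"
      "\<forall>g\<in>carrier G. \<forall>\<phi>\<in>hom G G. card {x\<in>carrier G. g \<otimes>\<^bsub>G\<^esub> \<phi> x = f x} \<le> k" by auto
    have "agreement G A (restrict f (carrier G)) \<le> k" if "A \<in> Aff G" for A
    proof -
      obtain g \<phi> where A: "g \<in> carrier G" "\<phi> \<in> End G" "A = affine_map G g \<phi>"
        using \<open>A \<in> Aff G\<close> by (auto simp: Aff_def)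
      have "agreement G A (restrict f (carrier G)) = card {x\<in>carrier G. g \<otimes>\<^bsub>G\<^esub> \<phi> x = f x}"
        unfolding agreement_def affine_map_def A(3) by (rule arg_cong[where f = card]) auto
      then show ?thesis using f(2) A by (auto simp: End_def)
    qed
    then show ?L using f by (intro bexI[of _ "restrict f (carrier G)"]) auto
  qed
  finally show ?thesis .
qed

lemma endapp_le_affapp:
  assumes "group G" "finite (carrier G)"
  shows "endapp G \<le> affapp G"
proof -
  interpret group G by fact
  obtain f where f: "f \<in> carrier G \<rightarrow> carrier G" and
    le: "\<forall>g\<in>carrier G. \<forall>\<phi>\<in>hom G G. card {x\<in>carrier G. g \<otimes>\<^bsub>G\<^esub> \<phi> x = f x} \<le> affapp G"
    using affapp_le_iff[OF assms, of "affapp G"] by auto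
  have "card {x\<in>carrier G. \<phi> x = f x} \<le> affapp G" if "\<phi> \<in> hom G G" for \<phi>
  proof -
    have "{x\<in>carrier G. \<phi> x = f x} = {x\<in>carrier G. \<one>\<^bsub>G\<^esub> \<otimes>\<^bsub>G\<^esub> \<phi> x = f x}"
      using that by (auto simp: hom_def Pi_iff)
    then show ?thesis using le that by simp
  qed
  then show ?thesis using f endapp_le_iff[OF assms] by auto
qed

text \<open>The trivial endomorphism followed by translation by \<open>f \<one>\<close> is a
  constant affine map that meets \<open>f\<close> at the neutral element.\<close>

lemma affapp_ge_1:
  assumes "group G" "finite (carrier G)"
  shows "1 \<le> affapp G"
proof (rule ccontr)
  interpret group G by fact
  assume "\<not> 1 \<le> affapp G"
  then obtain f where f: "f \<in> carrier G \<rightarrow> carrier G" and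
    le: "\<forall>g\<in>carrier G. \<forall>\<phi>\<in>hom G G. card {x\<in>carrier G. g \<otimes>\<^bsub>G\<^esub> \<phi> x = f x} \<le> 0"
    using affapp_le_iff[OF assms, of 0] by auto
  have "card {x\<in>carrier G. f \<one>\<^bsub>G\<^esub> \<otimes>\<^bsub>G\<^esub> \<one>\<^bsub>G\<^esub> = f x} \<le> 0"
    using le[rule_format, of "f \<one>\<^bsub>G\<^esub>" "\<lambda>_. \<one>\<^bsub>G\<^esub>"] f const_one_in_hom by (simp add: Pi_iff)
  then have "{x\<in>carrier G. f \<one>\<^bsub>G\<^esub> \<otimes>\<^bsub>G\<^esub> \<one>\<^bsub>G\<^esub> = f x} = {}" using assms(2) by simp
  moreover have "\<one>\<^bsub>G\<^esub> \<in> {x\<in>carrier G. f \<one>\<^bsub>G\<^esub> \<otimes>\<^bsub>G\<^esub> \<one>\<^bsub>G\<^esub> = f x}" using f by (simp add: Pi_iff)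
  ultimately show False by blast
qed

text \<open>If \<open>h\<close> is an isomorphism with inverse \<open>k\<close>, an optimal
  \<open>f\<close> on \<open>G\<close> is transported to \<open>h \<circ> f \<circ> k\<close> on
  \<open>H\<close>, and conjugation turns each map on \<open>H\<close> into one on \<open>G\<close>
  with equally many agreements. The opposite inequalities follow by symmetry.\<close>

lemma iso_endapp_affapp_le:
  assumes G: "group G" "finite (carrier G)" and H: "group H" "finite (carrier H)"
    and GH: "G \<cong> H"
  shows "endapp H \<le> endapp G" "affapp H \<le> affapp G"
proof -
  interpret G: group G by fact
  interpret H: group H by fact
  obtain h where h: "h \<in> iso G H" using GH by (auto simp: is_iso_def)
  define k where "k = inv_into (carrier G) h"
  have k: "k \<in> iso H G" unfolding k_def using h by (rule G.iso_set_sym)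
  have hom: "h \<in> hom G H" "k \<in> hom H G" using h k by (auto simp: iso_def)
  have bij: "bij_betw h (carrier G) (carrier H)" using h by (simp add: iso_def)
  have hk [simp]: "h (k y) = y" if "y \<in> carrier H" for y
    using that bij unfolding k_def by (simp add: bij_betw_inv_into_right)
  have kh [simp]: "k (h x) = x" if "x \<in> carrier G" for x
    using that bij unfolding k_def by (simp add: bij_betw_inv_into_left)
  have hc [simp]: "h x \<in> carrier H" if "x \<in> carrier G" for x using that hom(1) by (auto simp: hom_def)
  have kc [simp]: "k x \<in> carrier G" if "x \<in> carrier H" for x using that hom(2) by (auto simp: hom_def)
  have conj_hom: "k \<circ> \<phi> \<circ> h \<in> hom G G" if "\<phi> \<in> hom H H" for \<phi>
    using hom that by (meson hom_compose)
  have card_eq: "card {y\<in>carrier H. P y} = card {x\<in>carrier G. P (h x)}" for P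
  proof -
    have "bij_betw h {x\<in>carrier G. P (h x)} {y\<in>carrier H. P y}"
      using bij by (auto simp: bij_betw_def inj_on_def)
    then show ?thesis by (metis bij_betw_same_card)
  qed
  obtain f where f: "f \<in> carrier G \<rightarrow> carrier G"
    "\<forall>\<phi>\<in>hom G G. card {x\<in>carrier G. \<phi> x = f x} \<le> endapp G"
    using endapp_le_iff[OF G, of "endapp G"] by auto
  have "card {y\<in>carrier H. \<phi> y = (h \<circ> f \<circ> k) y} \<le> endapp G" if \<phi>: "\<phi> \<in> hom H H" for \<phi>
  proof -
    have "{x\<in>carrier G. \<phi> (h x) = (h \<circ> f \<circ> k) (h x)} = {x\<in>carrier G. (k \<circ> \<phi> \<circ> h) x = f x}"
    proof (rule Collect_cong, rule conj_cong[OF refl])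
      fix x assume x: "x \<in> carrier G"
      have "\<phi> (h x) \<in> carrier H" "f x \<in> carrier G" using x \<phi> f(1) by (auto simp: hom_def)
      then show "\<phi> (h x) = (h \<circ> f \<circ> k) (h x) \<longleftrightarrow> (k \<circ> \<phi> \<circ> h) x = f x"
        using x by (auto dest: arg_cong[of _ _ k] arg_cong[of _ _ h])
    qed
    then show ?thesis using f(2) conj_hom[OF \<phi>] by (simp add: card_eq del: comp_apply)
  qed
  moreover have "h \<circ> f \<circ> k \<in> carrier H \<rightarrow> carrier H" using f(1) by (simp add: Pi_iff)
  ultimately show "endapp H \<le> endapp G" using endapp_le_iff[OF H] by blast
  obtain f where f: "f \<in> carrier G \<rightarrow> carrier G"
    "\<forall>g\<in>carrier G. \<forall>\<phi>\<in>hom G G. card {x\<in>carrier G. g \<otimes>\<^bsub>G\<^esub> \<phi> x = f x} \<le> affapp G"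
    using affapp_le_iff[OF G, of "affapp G"] by auto
  have "card {y\<in>carrier H. g \<otimes>\<^bsub>H\<^esub> \<phi> y = (h \<circ> f \<circ> k) y} \<le> affapp G"
    if g: "g \<in> carrier H" and \<phi>: "\<phi> \<in> hom H H" for g \<phi>
  proof -
    have "{x\<in>carrier G. g \<otimes>\<^bsub>H\<^esub> \<phi> (h x) = (h \<circ> f \<circ> k) (h x)}
        = {x\<in>carrier G. k g \<otimes>\<^bsub>G\<^esub> (k \<circ> \<phi> \<circ> h) x = f x}"
    proof (rule Collect_cong, rule conj_cong[OF refl])
      fix x assume x: "x \<in> carrier G"
      have c: "\<phi> (h x) \<in> carrier H" "f x \<in> carrier G" using x \<phi> f(1) by (auto simp: hom_def)
      then have e: "k (g \<otimes>\<^bsub>H\<^esub> \<phi> (h x)) = k g \<otimes>\<^bsub>G\<^esub> k (\<phi> (h x))"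
        using hom(2) g by (auto simp: hom_def)
      have "g \<otimes>\<^bsub>H\<^esub> \<phi> (h x) = h (f x) \<longleftrightarrow> k (g \<otimes>\<^bsub>H\<^esub> \<phi> (h x)) = f x"
        using c g by (metis H.m_closed hk kh)
      then show "g \<otimes>\<^bsub>H\<^esub> \<phi> (h x) = (h \<circ> f \<circ> k) (h x) \<longleftrightarrow> k g \<otimes>\<^bsub>G\<^esub> (k \<circ> \<phi> \<circ> h) x = f x"
        using x e by simp
    qed
    then show ?thesis using f(2) g conj_hom[OF \<phi>] by (simp add: card_eq del: comp_apply)
  qed
  moreover have "h \<circ> f \<circ> k \<in> carrier H \<rightarrow> carrier H" using f(1) by (simp add: Pi_iff)
  ultimately show "affapp H \<le> affapp G" using affapp_le_iff[OF H] by blast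
qed

lemma iso_endapp_affapp_eq:
  assumes G: "group G" "finite (carrier G)" and H: "group H" "finite (carrier H)"
    and GH: "G \<cong> H"
  shows "endapp G = endapp H" "affapp G = affapp H"
  using iso_endapp_affapp_le[OF assms] iso_endapp_affapp_le[OF H G group.iso_sym[OF G(1) GH]]
  by auto

section \<open>Upper bounds\<close>

lemma card_functions_agreeing:
  assumes C: "finite C" and M: "M \<subseteq> C"
  shows "card {f \<in> C \<rightarrow>\<^sub>E C. \<forall>x\<in>M. h x = f x} \<le> card C ^ (card C - card M)"
proof -
  \<comment> \<open>On \<open>M\<close> such a function is prescribed by \<open>h\<close>, so its
    values on \<open>C - M\<close> determine it.\<close>
  have "inj_on (\<lambda>f. restrict f (C - M)) {f \<in> C \<rightarrow>\<^sub>E C. \<forall>x\<in>M. h x = f x}"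
  proof (rule inj_onI, rule ext)
    fix f f' x
    assume f: "f \<in> {f \<in> C \<rightarrow>\<^sub>E C. \<forall>x\<in>M. h x = f x}" and f': "f' \<in> {f \<in> C \<rightarrow>\<^sub>E C. \<forall>x\<in>M. h x = f x}"
      and eq: "restrict f (C - M) = restrict f' (C - M)"
    consider "x \<in> M" | "x \<in> C - M" | "x \<notin> C" by auto
    then show "f x = f' x"
    proof cases
      case 1 then show ?thesis using f f' by auto
    next
      case 2 then show ?thesis using fun_cong[OF eq, of x] by simp
    next
      case 3 then show ?thesis using f f' by (auto simp: PiE_def extensional_def)
    qed
  qed
  moreover have "(\<lambda>f. restrict f (C - M)) ` {f \<in> C \<rightarrow>\<^sub>E C. \<forall>x\<in>M. h x = f x} \<subseteq> (C - M) \<rightarrow>\<^sub>E C"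
    by auto
  ultimately have "card {f \<in> C \<rightarrow>\<^sub>E C. \<forall>x\<in>M. h x = f x} \<le> card ((C - M) \<rightarrow>\<^sub>E C)"
    using C by (intro card_inj_on_le) (auto simp: finite_PiE)
  also have "\<dots> = card C ^ (card C - card M)"
    using C M by (simp add: card_funcsetE card_Diff_subset finite_subset)
  finally show ?thesis .
qed

lemma fact_le_card_approximants:
  assumes C: "finite C" "C \<noteq> {}" and F: "finite F"
    and approx: "\<And>f. f \<in> C \<rightarrow>\<^sub>E C \<Longrightarrow> \<exists>h\<in>F. m \<le> card {x\<in>C. h x = f x}"
  shows "fact m \<le> card F"
proof -
  define n where "n = card C"
  have n: "n > 0" using C by (auto simp: n_def card_gt_0_iff)
  define S where "S = {M. M \<subseteq> C \<and> card M = m}"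
  have S: "finite S" "card S = n choose m"
    using C(1) by (auto simp: S_def n_def n_subsets)
  define E where "E h M = {f \<in> C \<rightarrow>\<^sub>E C. \<forall>x\<in>M. h x = f x}" for h :: "'a \<Rightarrow> 'a" and M
  have finC: "finite (C \<rightarrow>\<^sub>E C)" using C by (simp add: finite_PiE)
  \<comment> \<open>Each function lies in \<open>E h M\<close> for an \<open>m\<close>-element set
    \<open>M\<close> of points where it agrees with its approximant \<open>h\<close>.\<close>
  have sub: "C \<rightarrow>\<^sub>E C \<subseteq> (\<Union>(h, M)\<in>F \<times> S. E h M)"
  proof
    fix f assume f: "f \<in> C \<rightarrow>\<^sub>E C"
    obtain h where h: "h \<in> F" "m \<le> card {x\<in>C. h x = f x}" using approx[OF f] by auto
    obtain M where M: "M \<subseteq> {x\<in>C. h x = f x}" "card M = m"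
      using obtain_subset_with_card_n[OF h(2)] by blast
    then show "f \<in> (\<Union>(h, M)\<in>F \<times> S. E h M)" using f h(1) by (auto simp: S_def E_def)
  qed
  \<comment> \<open>Any single function shows \<open>m \<le> n\<close>; the identity is taken. This
    inequality makes \<open>n choose m\<close> positive for the final cancellation.\<close>
  have "(\<lambda>x\<in>C. x) \<in> C \<rightarrow>\<^sub>E C" by auto
  from approx[OF this] obtain h where "m \<le> card {x\<in>C. h x = (\<lambda>x\<in>C. x) x}" by auto
  also have "\<dots> \<le> n" unfolding n_def using C(1) by (intro card_mono) auto
  finally have mn: "m \<le> n" .
  have "n ^ n = card (C \<rightarrow>\<^sub>E C)" using C by (simp add: n_def card_funcsetE)
  also have "\<dots> \<le> card (\<Union>(h, M)\<in>F \<times> S. E h M)"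
    using F S by (intro card_mono[OF _ sub] finite_UN_I) (auto simp: E_def intro: finite_subset[OF _ finC])
  also have "\<dots> \<le> (\<Sum>(h, M)\<in>F \<times> S. card (E h M))"
    using card_UN_le[of "F \<times> S" "\<lambda>(h, M). E h M"] F S by (simp add: case_prod_unfold)
  also have "\<dots> \<le> (\<Sum>_\<in>F \<times> S. n ^ (n - m))"
    using card_functions_agreeing[OF C(1)]
    by (intro sum_mono) (auto simp: S_def E_def n_def)
  also have "\<dots> = card F * (n choose m) * n ^ (n - m)"
    using F S by (simp add: card_cartesian_product)
  finally have "n ^ m * n ^ (n - m) \<le> (card F * (n choose m)) * n ^ (n - m)"
    using mn by (simp flip: power_add)
  then have "n ^ m \<le> card F * (n choose m)" using n by simp
  \<comment> \<open>Since \<open>n choose m\<close> times \<open>fact m\<close> is at most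
    \<open>n ^ m\<close>, the binomial coefficient cancels and only the factorial remains.\<close>
  then have "(n choose m) * fact m \<le> card F * (n choose m)"
    using binomial_fact_pow[of n m] by linarith
  moreover have "n choose m > 0" using mn by simp
  ultimately show ?thesis by (simp add: mult.commute)
qed

section \<open>Generating sets and the number of endomorphisms\<close>

lemma (in group) ex_small_generating_set:
  assumes fin: "finite (carrier G)"
  shows "\<exists>S. S \<subseteq> carrier G \<and> generate G S = carrier G \<and> 2 ^ card S \<le> order G"
proof -
  \<comment> \<open>A largest set with \<open>P\<close> generates the group: adjoining an element
    outside the generated subgroup at least doubles that subgroup, so \<open>P\<close> would survive
    the enlargement.\<close>
  define P where "P S \<longleftrightarrow> S \<subseteq> carrier G \<and> 2 ^ card S \<le> card (generate G S)" for S
  have "P {}" using generate_empty by (simp add: P_def)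
  moreover have "\<forall>S. P S \<longrightarrow> card S < Suc (card (carrier G))"
    by (auto simp: P_def fin card_mono less_Suc_eq_le)
  ultimately obtain S where S: "P S" and max: "\<And>S'. P S' \<Longrightarrow> card S' \<le> card S"
    using ex_has_greatest_nat[of P "{}" card "Suc (card (carrier G))"] by metis
  have Sc: "S \<subseteq> carrier G" using S by (simp add: P_def)
  have finS: "finite S" using Sc fin finite_subset by auto
  have "generate G S = carrier G"
  proof (rule ccontr)
    assume "generate G S \<noteq> carrier G"
    then obtain x where x: "x \<in> carrier G" "x \<notin> generate G S"
      using generate_incl[OF Sc] by auto
    have xS: "x \<notin> S" using x(2) generate.incl[of x S G] by auto
    have T: "insert x S \<subseteq> carrier G" using Sc x by auto
    let ?H = "generate G S" and ?K = "generate G (insert x S)"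
    have sub: "subgroup ?H G" "subgroup ?K G" using generate_is_subgroup Sc T by auto
    have HK: "?H \<subseteq> ?K" by (rule mono_generate) auto
    have Kc: "?K \<subseteq> carrier G" using generate_incl[OF T] .
    have fK: "finite ?K" using Kc fin finite_subset by auto
    have xK: "x \<in> ?K" by (rule generate.incl) simp
    \<comment> \<open>The coset lies in \<open>?K\<close>, is disjoint from \<open>?H\<close> and
      has the same size, hence \<open>?K\<close> is at least twice as large as
      \<open>?H\<close>.\<close>
    have "x <# ?H \<subseteq> ?K" using xK HK sub(2) by (auto simp: l_coset_def subgroup.m_closed)
    moreover have "?H \<inter> (x <# ?H) = {}"
    proof -
      have False if h: "h \<in> ?H" "x \<otimes> h \<in> ?H" for h
      proof -
        have hc: "h \<in> carrier G" using h sub(1) subgroup.mem_carrier by metis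
        have "(x \<otimes> h) \<otimes> inv h \<in> ?H"
          using h sub(1) by (simp add: subgroup.m_closed subgroup.m_inv_closed)
        then show False using x hc by (simp add: m_assoc)
      qed
      then show ?thesis by (auto simp: l_coset_def)
    qed
    moreover have "card (x <# ?H) = card ?H"
    proof -
      have "x <# ?H = (\<lambda>h. x \<otimes> h) ` ?H" by (auto simp: l_coset_def)
      moreover have "inj_on (\<lambda>h. x \<otimes> h) ?H"
        using x(1) sub(1) by (metis Units_eq Units_l_cancel inj_onI subgroup.mem_carrier)
      ultimately show ?thesis by (simp add: card_image)
    qed
    ultimately have "2 * card ?H \<le> card ?K"
      using HK fK by (metis Un_least card_Un_disjoint card_mono finite_subset mult_2)
    moreover have "2 ^ card S \<le> card ?H" using S by (simp add: P_def)
    ultimately have "P (insert x S)" using T finS xS by (simp add: P_def)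
    then show False using max[of "insert x S"] finS xS by simp
  qed
  then show ?thesis using S by (auto simp: P_def order_def)
qed

text \<open>An endomorphism is determined by its values on a generating set; \<open>d\<close> is the
  size of a small one.\<close>

lemma (in group) ex_card_End_le:
  assumes fin: "finite (carrier G)"
  shows "\<exists>d. 2 ^ d \<le> order G \<and> card (End G) \<le> order G ^ d"
proof -
  obtain S where S: "S \<subseteq> carrier G" "generate G S = carrier G" "2 ^ card S \<le> order G"
    using ex_small_generating_set[OF fin] by auto
  have "inj_on (\<lambda>\<phi>. restrict \<phi> S) (End G)"
  proof (rule inj_onI)
    fix \<phi> \<psi> assume p: "\<phi> \<in> End G" "\<psi> \<in> End G" and eq: "restrict \<phi> S = restrict \<psi> S"
    interpret \<phi>: group_hom G G \<phi> using p by unfold_locales (auto simp: End_def)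
    interpret \<psi>: group_hom G G \<psi> using p by unfold_locales (auto simp: End_def)
    have on_S: "\<phi> x = \<psi> x" if "x \<in> S" for x using fun_cong[OF eq, of x] that by simp
    have "\<phi> x = \<psi> x" if "x \<in> generate G S" for x
      using that
    proof induction
      case (eng h1 h2)
      then show ?case using S by (simp add: generate_in_carrier)
    qed (use on_S S in \<open>auto simp: subset_iff\<close>)
    then show "\<phi> = \<psi>"
      using p S(2) by (intro extensionalityI[of \<phi> "carrier G" \<psi>]) (auto simp: End_def)
  qed
  moreover have "(\<lambda>\<phi>. restrict \<phi> S) ` End G \<subseteq> S \<rightarrow>\<^sub>E carrier G"
    using S(1) by (auto simp: End_def hom_def)
  ultimately have "card (End G) \<le> card (S \<rightarrow>\<^sub>E carrier G)"
    using fin S(1) by (intro card_inj_on_le) (auto simp: finite_PiE finite_subset)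
  also have "\<dots> = order G ^ card S"
    using fin S(1) by (simp add: card_funcsetE finite_subset order_def)
  finally show ?thesis using S(3) by blast
qed

lemma (in group) card_Aff_le:
  assumes fin: "finite (carrier G)"
  shows "card (Aff G) \<le> order G * card (End G)"
proof -
  have "Aff G = (\<lambda>(g, \<phi>). affine_map G g \<phi>) ` (carrier G \<times> End G)"
    by (auto simp: Aff_def)
  then show ?thesis
    using fin finite_End[OF fin] card_image_le[of "carrier G \<times> End G" "\<lambda>(g, \<phi>). affine_map G g \<phi>"]
    by (simp add: card_cartesian_product order_def)
qed

text \<open>The counting lemma applies to the family \<open>End G\<close>: for every function the
  maximum over endomorphisms is attained, and it is at least the minimum over all functions.\<close>

lemma fact_endapp_le:
  assumes "group G" "finite (carrier G)"
  shows "fact (endapp G) \<le> card (End G)"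
proof -
  interpret group G by fact
  show ?thesis
  proof (rule fact_le_card_approximants[OF assms(2)])
    fix f assume f: "f \<in> carrier G \<rightarrow>\<^sub>E carrier G"
    have ne: "End G \<noteq> {}"
      using restrict_hom_in_End[OF assms(1) const_one_in_hom] by auto
    have "endapp G \<le> endapp_fun G f"
      using f assms(2) by (simp add: endapp_def finite_PiE)
    moreover have "endapp_fun G f \<in> (\<lambda>\<phi>. agreement G \<phi> f) ` End G"
      unfolding endapp_fun_def using ne finite_End[OF assms(2)] by (intro Max_in) auto
    ultimately show "\<exists>h\<in>End G. endapp G \<le> card {x \<in> carrier G. h x = f x}"
      by (auto simp: agreement_def)
  qed (use finite_End[OF assms(2)] in auto)
qed

lemma fact_affapp_le:
  assumes "group G" "finite (carrier G)"
  shows "fact (affapp G) \<le> card (Aff G)"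
proof -
  interpret group G by fact
  show ?thesis
  proof (rule fact_le_card_approximants[OF assms(2)])
    fix f assume f: "f \<in> carrier G \<rightarrow>\<^sub>E carrier G"
    have ne: "Aff G \<noteq> {}"
      using restrict_hom_in_End[OF assms(1) const_one_in_hom] by (auto simp: Aff_def)
    have "affapp G \<le> affapp_fun G f"
      using f assms(2) by (simp add: affapp_def finite_PiE)
    moreover have "affapp_fun G f \<in> (\<lambda>A. agreement G A f) ` Aff G"
      unfolding affapp_fun_def using ne finite_Aff[OF assms(2)] by (intro Max_in) auto
    ultimately show "\<exists>h\<in>Aff G. affapp G \<le> card {x \<in> carrier G. h x = f x}"
      by (auto simp: agreement_def)
  qed (use finite_Aff[OF assms(2)] in auto)
qed

section \<open>Numerical estimates\<close>

lemma three_pow_le_fact: "(3::nat) ^ m \<le> fact m" if "7 \<le> m"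
  using that
proof (induction m rule: nat_induct_at_least)
  case base
  \<comment> \<open>This is 2187 <= 5040, whereas 3^6 = 729 still exceeds 6! = 720.\<close>
  show ?case by (simp add: fact_numeral)
next
  case (Suc m)
  then have "3 * 3 ^ m \<le> Suc m * (fact m :: nat)" by (intro mult_mono) auto
  then show ?case by simp
qed

lemma real_le_ln_fact:
  assumes "7 \<le> m"
  shows "real m \<le> ln (fact m)"
proof -
  have "exp (real m) = exp 1 ^ m" by (simp flip: exp_of_nat_mult)
  also have "\<dots> \<le> 3 ^ m" using exp_le by (intro power_mono) auto
  also have "\<dots> = real (3 ^ m)" by simp
  also have "\<dots> \<le> real (fact m)" using three_pow_le_fact[OF assms] by (simp only: of_nat_le_iff)
  finally have "exp (real m) \<le> fact m" by simp
  then show ?thesis by (simp add: ln_ge_iff)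
qed

text \<open>Chains m <= ln(m!) <= (d + e) ln n with d <= log2 n. The exponent \<open>e\<close>
  accounts for the translations: it is 0 for endomorphisms and 1 for affine maps.\<close>

lemma le_of_fact_le:
  assumes m: "7 \<le> m" and n: "1 \<le> n" and d: "2 ^ d \<le> n" and le: "fact m \<le> n ^ (d + e)"
  shows "real m \<le> (ln (real n))\<^sup>2 / ln 2 + real e * ln (real n)"
proof -
  have "real m \<le> ln (fact m)" using real_le_ln_fact[OF m] .
  also have "\<dots> \<le> ln (real (n ^ (d + e)))"
  proof -
    have "real (fact m) \<le> real (n ^ (d + e))" using le by (simp only: of_nat_le_iff)
    then show ?thesis by (intro ln_mono) auto
  qed
  also have "\<dots> = (real d + real e) * ln (real n)" using n by (simp add: ln_realpow)
  also have "\<dots> \<le> (ln (real n) / ln 2 + real e) * ln (real n)"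
  proof (rule mult_right_mono)
    have "real (2 ^ d) \<le> real n" using d by (simp only: of_nat_le_iff)
    then have "ln (real (2 ^ d)) \<le> ln (real n)" using n by (intro ln_mono) auto
    then have "real d * ln 2 \<le> ln (real n)" by (simp add: ln_realpow)
    then show "real d + real e \<le> ln (real n) / ln 2 + real e"
      by (simp add: pos_le_divide_eq)
  qed (use n in auto)
  finally show ?thesis by (simp add: algebra_simps power2_eq_square)
qed

text \<open>With l = log2 n the right side equals ln 2 * l * (l + e). Replacing ln 2 by 2/3 and l by
  a rational lower bound p/q leaves an inequality between rationals.\<close>

lemma log_squared_bound:
  assumes "2 ^ p \<le> n ^ q" "0 < q" "0 < n" 
    and c: "c \<le> (2 / 3) * (real p / real q) * (real p / real q + e)" "0 \<le> e"
  shows "c \<le> (ln (real n))\<^sup>2 / ln 2 + e * ln (real n)"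
proof -
  define l where "l = ln (real n) / ln 2"
  have ln: "ln (real n) = l * ln 2" by (simp add: l_def)
  have "real (2 ^ p) \<le> real (n ^ q)" using assms(1) by (simp only: of_nat_le_iff)
  then have "ln (real (2 ^ p)) \<le> ln (real (n ^ q))" using assms by (intro ln_mono) auto
  then have "real p * ln 2 \<le> (real q * l) * ln 2" using assms by (simp add: ln_realpow ln)
  then have l: "real p / real q \<le> l" using assms(2) by (simp add: field_simps)
  have "c \<le> (2 / 3) * ((real p / real q) * (real p / real q + e))" using c by (simp add: mult.assoc)
  also have "\<dots> \<le> ln 2 * (l * (l + e))"
    using l c(2) ln2_ge_two_thirds
    by (intro mult_mono add_mono) (auto intro: order_trans[OF _ l])
  also have "\<dots> = (ln (real n))\<^sup>2 / ln 2 + e * ln (real n)"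
    unfolding ln by (simp add: field_simps power2_eq_square)
  finally show ?thesis .
qed

lemma log_squared_bound_seven:
  assumes n: "4 \<le> n" and e: "1 \<le> e"
  shows "min (real n) 7 \<le> (ln (real n))\<^sup>2 / ln 2 + e * ln (real n)"
proof -
  have *: "real n / 1 \<le> (2 / 3) * (real p / real q) * (real p / real q + e)"
    if "real n \<le> (2 / 3) * (real p / real q) * (real p / real q + 1)" for p q
  proof -
    have "(2 / 3) * (real p / real q) * (real p / real q + 1) \<le> (2 / 3) * (real p / real q) * (real p / real q + e)"
      using e by (intro mult_left_mono) auto
    then show ?thesis using that by simp
  qed
  \<comment> \<open>The lower bounds for log2 n used are 2, 23/10, 18/7 and 14/5; the last one comes
    from 2^14 <= 7^5 and serves for every larger n.\<close>
  consider "n = 4" | "n = 5" | "n = 6" | "7 \<le> n" using n by linarith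
  then show ?thesis
  proof cases
    case 1
    then show ?thesis using log_squared_bound[of 2 n 1 4 e] *[of 2 1] e by simp
  next
    case 2
    then show ?thesis using log_squared_bound[of 23 n 10 5 e] *[of 23 10] e by simp
  next
    case 3
    then show ?thesis using log_squared_bound[of 18 n 7 6 e] *[of 18 7] e by simp
  next
    case 4
    have "7 \<le> (2 / 3) * (14 / 5) * (14 / 5 + e)" using e by simp
    moreover have "7 ^ 5 \<le> n ^ 5" using 4 by (intro power_mono) auto
    then have "2 ^ 14 \<le> n ^ 5" by simp
    ultimately show ?thesis using log_squared_bound[of 14 n 5 7 e] 4 e by simp
  qed
qed

section \<open>The two upper bounds, including small groups\<close>

lemma real_endapp_le:
  assumes "group G" "finite (carrier G)" "\<not> trivial_group G"
  shows "real (endapp G) \<le> (ln (real (order G)))\<^sup>2 / ln 2 + ln (real (order G))"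
proof -
  interpret group G by fact
  obtain d where d: "2 ^ d \<le> order G" "card (End G) \<le> order G ^ d"
    using ex_card_End_le[OF assms(2)] by auto
  have fact: "fact (endapp G) \<le> order G ^ d"
    using fact_endapp_le[OF assms(1,2)] d(2) by linarith
  obtain a where a: "a \<in> carrier G" "a \<noteq> \<one>\<^bsub>G\<^esub>" using assms(1,3) by (auto simp: trivial_group_def)
  \<comment> \<open>A constant function with value \<open>a \<noteq> \<one>\<close> differs from
    every endomorphism at the neutral element. The gain of 1 over the order matters for orders 2 and
    3, where the claimed bound is below the order.\<close>
  have "endapp G \<le> order G - 1"
  proof -
    have "card {x \<in> carrier G. \<phi> x = a} \<le> order G - 1" if "\<phi> \<in> hom G G" for \<phi>
    proof -
      interpret group_hom G G \<phi> using that by unfold_locales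
      have "{x \<in> carrier G. \<phi> x = a} \<subseteq> carrier G - {\<one>\<^bsub>G\<^esub>}" using a by auto
      then have "card {x \<in> carrier G. \<phi> x = a} \<le> card (carrier G - {\<one>\<^bsub>G\<^esub>})"
        using assms(2) by (intro card_mono) auto
      then show ?thesis using assms(2) by (simp add: order_def)
    qed
    then show ?thesis unfolding endapp_le_iff[OF assms(1,2)] using a by (intro bexI[of _ "\<lambda>_. a"]) auto
  qed
  moreover have "card {\<one>\<^bsub>G\<^esub>, a} \<le> order G"
    unfolding order_def using a assms(2) by (intro card_mono) auto
  then have "2 \<le> order G" using a by simp
  ultimately consider "7 \<le> endapp G" | "endapp G < 7" "4 \<le> order G" "endapp G \<le> order G"
    | "order G = 2" "endapp G \<le> 1" | "order G = 3" "endapp G \<le> 2"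
    by linarith
  then show ?thesis
  proof cases
    case 1
    then show ?thesis using le_of_fact_le[of "endapp G" "order G" d 0] d(1) fact \<open>2 \<le> order G\<close>
      by (simp add: add.commute add_increasing)
  next
    case 2
    then show ?thesis using log_squared_bound_seven[of "order G" 1] by simp
  next
    case 3
    then show ?thesis using log_squared_bound[of 1 2 1 1 1] by simp
  next
    case 4
    then show ?thesis using log_squared_bound[of 3 3 2 2 1] by simp
  qed
qed

lemma affapp_le_order:
  assumes "group G" "finite (carrier G)"
  shows "affapp G \<le> order G"
  unfolding affapp_le_iff[OF assms] order_def using assms(2)
  by (intro bexI[of _ "\<lambda>x. x"] ballI card_mono) auto

lemma real_affapp_le:
  assumes "group G" "finite (carrier G)" "\<not> trivial_group G"
  shows "real (affapp G) \<le> (ln (real (order G)))\<^sup>2 / ln 2 + 2 * ln (real (order G))"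
proof -
  interpret group G by fact
  obtain d where d: "2 ^ d \<le> order G" "card (End G) \<le> order G ^ d"
    using ex_card_End_le[OF assms(2)] by auto
  have "fact (affapp G) \<le> order G * card (End G)"
    using fact_affapp_le[OF assms(1,2)] card_Aff_le[OF assms(2)] by linarith
  also have "\<dots> \<le> order G ^ (d + 1)" using d(2) by simp
  finally have fact: "fact (affapp G) \<le> order G ^ (d + 1)" .
  obtain a where a: "a \<in> carrier G" "a \<noteq> \<one>\<^bsub>G\<^esub>" using assms(1,3) by (auto simp: trivial_group_def)
  have "card {\<one>\<^bsub>G\<^esub>, a} \<le> order G"
    unfolding order_def using a assms(2) by (intro card_mono) auto
  then have "2 \<le> order G" using a by simp
  \<comment> \<open>Counting yields the coefficient 1 for the linear term. The coefficient 2 lets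
    the bound by the order settle orders 2 and 3, where the coefficient 1 would be too small for
    that.\<close>
  then consider "7 \<le> affapp G" | "affapp G < 7" "4 \<le> order G" "affapp G \<le> order G"
    | "order G = 2" "affapp G \<le> 2" | "order G = 3" "affapp G \<le> 3"
    using affapp_le_order[OF assms(1,2)] by linarith
  then show ?thesis
  proof cases
    case 1
    have "real (affapp G) \<le> (ln (real (order G)))\<^sup>2 / ln 2 + 1 * ln (real (order G))"
      using le_of_fact_le[of "affapp G" "order G" d 1] 1 d(1) fact \<open>2 \<le> order G\<close> by simp
    moreover have "0 \<le> ln (real (order G))" using \<open>2 \<le> order G\<close> by simp
    ultimately show ?thesis by linarith
  next
    case 2
    then show ?thesis using log_squared_bound_seven[of "order G" 2] by simp
  next
    case 3
    then show ?thesis using log_squared_bound[of 1 2 1 2 2] by simp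
  next
    case 4
    then show ?thesis using log_squared_bound[of 3 3 2 3 2] by simp
  qed
qed

section \<open>Limits over large finite groups\<close>

text \<open>Turns the filter into a threshold on the order; the limit statements below are reduced
  to this form.\<close>

lemma eventually_large_finite_groups:
  "eventually P large_finite_groups \<longleftrightarrow>
   (\<exists>N. \<forall>G. group G \<and> finite (carrier G) \<and> N \<le> order G \<longrightarrow> P G)"
proof
  assume "eventually P large_finite_groups"
  then obtain Q where Q: "eventually Q at_top"
    "\<And>G. Q (order G) \<Longrightarrow> group G \<and> finite (carrier G) \<Longrightarrow> P G"
    unfolding large_finite_groups_def eventually_inf_principal eventually_filtercomap
    by (auto simp: order_def)
  then show "\<exists>N. \<forall>G. group G \<and> finite (carrier G) \<and> N \<le> order G \<longrightarrow> P G"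
    unfolding eventually_at_top_linorder by meson
next
  assume "\<exists>N. \<forall>G. group G \<and> finite (carrier G) \<and> N \<le> order G \<longrightarrow> P G"
  then obtain N where "\<And>G. group G \<and> finite (carrier G) \<and> N \<le> order G \<Longrightarrow> P G" by auto
  then show "eventually P large_finite_groups"
    unfolding large_finite_groups_def eventually_inf_principal eventually_filtercomap
    by (intro exI[of _ "\<lambda>n. N \<le> n"]) (auto simp: eventually_ge_at_top)
qed

lemma affapp_bigo:
  "(\<lambda>G. real (affapp G)) \<in> O[large_finite_groups](\<lambda>G. (ln (real (order G)))\<^sup>2)"
proof (rule bigoI[of _ "1 / ln 2 + 2"])
  have "norm (real (affapp G)) \<le> (1 / ln 2 + 2) * norm ((ln (real (order G)))\<^sup>2)"
    if G: "group G" "finite (carrier G)" "3 \<le> order G" for G :: "('a, 'b) monoid_scheme"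
  proof -
    have "\<not> trivial_group G" using G(3) by (auto simp: trivial_group_def order_def)
    then have "real (affapp G) \<le> (ln (real (order G)))\<^sup>2 / ln 2 + 2 * ln (real (order G))"
      using real_affapp_le G by blast
    \<comment> \<open>Since e <= 3 <= |G|, the logarithm is at least 1, so the square absorbs the
      linear term.\<close>
    moreover have "1 \<le> ln (real (order G))"
      using G(3) exp_le by (subst ln_ge_iff) auto
    then have "1 * ln (real (order G)) \<le> ln (real (order G)) * ln (real (order G))"
      by (intro mult_right_mono) auto
    ultimately show ?thesis by (simp add: algebra_simps power2_eq_square)
  qed
  then show "\<forall>\<^sub>F G :: ('a, 'b) monoid_scheme in large_finite_groups.
      norm (real (affapp G)) \<le> (1 / ln 2 + 2) * norm ((ln (real (order G)))\<^sup>2)"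
    unfolding eventually_large_finite_groups by blast
qed

text \<open>Any property that holds eventually holds for all groups beyond some order, and among
  these \<open>F\<close> is unbounded; so every supremum in the definition of \<open>Limsup\<close>
  is infinite.\<close>

lemma Limsup_large_finite_groups_eq_PInf:
  fixes F :: "('a, 'b) monoid_scheme \<Rightarrow> nat"
  assumes "\<And>n. \<exists>G. group G \<and> finite (carrier G) \<and> n \<le> order G \<and> n \<le> F G"
  shows "Limsup large_finite_groups (\<lambda>G. ereal (real (F G))) = \<infinity>"
proof -
  have "(SUP G\<in>Collect P. ereal (real (F G))) = \<infinity>" if P: "eventually P large_finite_groups" for P
  proof (rule SUP_PInfty)
    fix n :: nat
    obtain N where N: "\<And>G. group G \<and> finite (carrier G) \<and> N \<le> order G \<Longrightarrow> P G"
      using P unfolding eventually_large_finite_groups by blast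
    obtain G :: "('a, 'b) monoid_scheme"
      where "group G" "finite (carrier G)" "max n N \<le> order G" "max n N \<le> F G"
      using assms by blast
    then show "\<exists>G\<in>Collect P. ereal (real n) \<le> ereal (real (F G))"
      using N by (intro bexI[of _ G]) auto
  qed
  then show ?thesis unfolding Limsup_def by (simp flip: top_ereal_def)
qed

lemma Liminf_large_finite_groups_eq:
  fixes F :: "('a, 'b) monoid_scheme \<Rightarrow> nat"
  assumes ge: "\<And>G. group G \<Longrightarrow> finite (carrier G) \<Longrightarrow> c \<le> F G"
    and freq: "\<And>n. \<exists>G. group G \<and> finite (carrier G) \<and> n \<le> order G \<and> F G = c"
  shows "Liminf large_finite_groups (\<lambda>G. ereal (real (F G))) = ereal (real c)"
proof (rule antisym)
  show "Liminf large_finite_groups (\<lambda>G. ereal (real (F G))) \<le> ereal (real c)"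
    unfolding Liminf_def
  proof (rule SUP_least)
    fix P assume "P \<in> {P :: ('a, 'b) monoid_scheme \<Rightarrow> bool. eventually P large_finite_groups}"
    then obtain N where N: "\<And>G. group G \<and> finite (carrier G) \<and> N \<le> order G \<Longrightarrow> P G"
      unfolding eventually_large_finite_groups by blast
    obtain G :: "('a, 'b) monoid_scheme"
      where "group G" "finite (carrier G)" "N \<le> order G" "F G = c"
      using freq by blast
    then show "(INF G\<in>Collect P. ereal (real (F G))) \<le> ereal (real c)"
      using N by (intro INF_lower2[of G]) auto
  qed
  show "ereal (real c) \<le> Liminf large_finite_groups (\<lambda>G. ereal (real (F G)))"
    by (rule Liminf_bounded) (auto simp: eventually_large_finite_groups intro: ge)
qed

section \<open>Transfer of examples to groups on the natural numbers, and families with distinct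
  orders\<close>

lemma ex_nat_monoid:
  assumes "group G" "finite (carrier G)"
  shows "\<exists>H :: nat monoid. group H \<and> finite (carrier H) \<and> order H = order G \<and>
    endapp H = endapp G \<and> affapp H = affapp G"
proof -
  obtain H :: "nat monoid" where H: "group H" "finite (carrier H)" "G \<cong> H"
    using finite_group_iso_nat[OF assms] by blast
  then show ?thesis
    using iso_endapp_affapp_eq[OF assms H] iso_same_card[OF H(3)] by (auto simp: order_def)
qed

text \<open>Groups of different orders are not isomorphic, so it suffices to choose one group for
  each of infinitely many orders.\<close>

lemma infinite_class_of_orders:
  fixes P :: "nat monoid \<Rightarrow> bool"
  assumes "\<And>n. \<exists>G. P G \<and> n \<le> order G"
  shows "\<exists>\<G>. infinite \<G> \<and> pairwise (\<lambda>G K. \<not> G \<cong> K) \<G> \<and> (\<forall>G\<in>\<G>. P G)"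
proof -
  define \<O> where "\<O> = order ` {G. P G}"
  have "infinite \<O>"
    unfolding infinite_nat_iff_unbounded_le \<O>_def using assms by blast
  define g where "g n = (SOME G. P G \<and> order G = n)" for n
  have g: "P (g n)" "order (g n) = n" if "n \<in> \<O>" for n
  proof -
    have "\<exists>G. P G \<and> order G = n" using that by (auto simp: \<O>_def)
    then have "P (g n) \<and> order (g n) = n" unfolding g_def by (rule someI_ex)
    then show "P (g n)" "order (g n) = n" by auto
  qed
  have "inj_on g \<O>" using g(2) by (metis inj_onI)
  then have "infinite (g ` \<O>)" using \<open>infinite \<O>\<close> by (simp add: finite_image_iff)
  moreover have "pairwise (\<lambda>G K. \<not> G \<cong> K) (g ` \<O>)"
    using g(2) by (auto simp: pairwise_def order_def dest!: iso_same_card)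
  ultimately show ?thesis using g(1) by (intro exI[of _ "g ` \<O>"]) auto
qed

section \<open>Elementary abelian 2-groups\<close>

text \<open>The vector space F_2^d, each vector encoded by its support; the singletons are the
  standard basis.\<close>

definition subset_group :: "nat \<Rightarrow> nat set monoid" where
  "subset_group d = \<lparr>carrier = Pow {..<d}, monoid.mult = (\<lambda>A B. sym_diff A B), one = {}\<rparr>"

lemma group_subset_group: "group (subset_group d)"
  by (rule groupI) (auto simp: subset_group_def)

lemma finite_subset_group: "finite (carrier (subset_group d))"
  by (simp add: subset_group_def)

lemma order_subset_group: "order (subset_group d) = 2 ^ d"
  by (simp add: order_def subset_group_def card_Pow)

text \<open>Additivity of parity is what makes \<open>extend_basis\<close> a homomorphism.\<close>

lemma even_card_sym_diff:
  assumes "finite A" "finite B"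
  shows "even (card (sym_diff A B)) \<longleftrightarrow> (even (card A) \<longleftrightarrow> even (card B))"
proof -
  have "card (sym_diff A B) + 2 * card (A \<inter> B) = card A + card B"
  proof -
    have "card (sym_diff A B) = card (A - B) + card (B - A)"
      using assms by (intro card_Un_disjoint) auto
    moreover have "card (A - B) + card (A \<inter> B) = card A"
      using assms(1) by (metis card_Diff_subset_Int card_mono finite_Int inf_le1 le_add_diff_inverse2)
    moreover have "card (B - A) + card (A \<inter> B) = card B"
      using assms by (metis Int_commute card_Diff_subset_Int card_mono finite_Int inf_le1 le_add_diff_inverse2)
    ultimately show ?thesis by simp
  qed
  then show ?thesis by presburger
qed

text \<open>The linear map that sends the basis vector \<open>{i}\<close> to \<open>F i\<close>:
  coordinate \<open>j\<close> of the image of \<open>A\<close> is the sum modulo 2 of the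
  coordinates \<open>j\<close> of the vectors \<open>F i\<close> with \<open>i\<close> in
  \<open>A\<close>.\<close>

definition extend_basis :: "nat \<Rightarrow> (nat \<Rightarrow> nat set) \<Rightarrow> nat set \<Rightarrow> nat set" where
  "extend_basis d F A = {j. j < d \<and> odd (card {i\<in>A. j \<in> F i})}"

lemma extend_basis_hom: "extend_basis d F \<in> hom (subset_group d) (subset_group d)"
proof (rule homI)
  fix A B assume "A \<in> carrier (subset_group d)" "B \<in> carrier (subset_group d)"
  then have fin: "finite A" "finite B" by (auto simp: subset_group_def finite_subset)
  have "{i \<in> sym_diff A B. j \<in> F i} = sym_diff {i\<in>A. j \<in> F i} {i\<in>B. j \<in> F i}" for j
    by auto
  then have "odd (card {i \<in> sym_diff A B. j \<in> F i}) \<longleftrightarrow>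
      (odd (card {i\<in>A. j \<in> F i}) \<noteq> odd (card {i\<in>B. j \<in> F i}))" for j
    using even_card_sym_diff[of "{i\<in>A. j \<in> F i}" "{i\<in>B. j \<in> F i}"] fin by simp
  then show "extend_basis d F (A \<otimes>\<^bsub>subset_group d\<^esub> B)
      = extend_basis d F A \<otimes>\<^bsub>subset_group d\<^esub> extend_basis d F B"
    by (auto simp: extend_basis_def subset_group_def)
qed (auto simp: extend_basis_def subset_group_def)

lemma extend_basis_singleton:
  assumes "F i \<subseteq> {..<d}"
  shows "extend_basis d F {i} = F i"
proof -
  have "{i' \<in> {i}. j \<in> F i'} = (if j \<in> F i then {i} else {})" for j by auto
  then show ?thesis using assms by (auto simp: extend_basis_def)
qed

lemma endapp_subset_group_ge: "d \<le> endapp (subset_group d)"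
proof -
  let ?G = "subset_group d"
  obtain f where f: "f \<in> carrier ?G \<rightarrow> carrier ?G"
    and le: "\<And>\<phi>. \<phi> \<in> hom ?G ?G \<Longrightarrow> card {x\<in>carrier ?G. \<phi> x = f x} \<le> endapp ?G"
    using endapp_le_iff[OF group_subset_group finite_subset_group, of d "endapp ?G"] by auto
  let ?\<phi> = "extend_basis d (\<lambda>i. f {i})"
  have "(\<lambda>i. {i}) ` {..<d} \<subseteq> {x\<in>carrier ?G. ?\<phi> x = f x}"
    using f extend_basis_singleton[of "\<lambda>i. f {i}" _ d] by (auto simp: subset_group_def Pi_iff)
  then have "card ((\<lambda>i. {i}) ` {..<d}) \<le> card {x\<in>carrier ?G. ?\<phi> x = f x}"
    using finite_subset_group by (intro card_mono) auto
  also have "\<dots> \<le> endapp ?G" by (rule le[OF extend_basis_hom])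
  finally show ?thesis by (simp add: card_image)
qed

lemma affapp_subset_group_ge: "d + 1 \<le> affapp (subset_group d)"
proof -
  let ?G = "subset_group d"
  obtain f where f: "f \<in> carrier ?G \<rightarrow> carrier ?G"
    and le: "\<And>g \<phi>. g \<in> carrier ?G \<Longrightarrow> \<phi> \<in> hom ?G ?G \<Longrightarrow>
      card {x\<in>carrier ?G. g \<otimes>\<^bsub>?G\<^esub> \<phi> x = f x} \<le> affapp ?G"
    using affapp_le_iff[OF group_subset_group finite_subset_group, of d "affapp ?G"] by auto
  \<comment> \<open>Translating by \<open>f {}\<close> moves the value at the neutral element to
    zero; adding \<open>f {}\<close> back undoes this, as every element is its own inverse.\<close>
  let ?F = "\<lambda>i. sym_diff (f {}) (f {i})"
  let ?\<phi> = "extend_basis d ?F"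
  have f0: "f {} \<in> carrier ?G" using f by (auto simp: subset_group_def)
  have F: "?F i \<subseteq> {..<d}" if "i < d" for i
    using f that by (auto simp: subset_group_def Pi_iff subset_iff)
  have "?\<phi> {} = {}" by (simp add: extend_basis_def)
  then have "insert {} ((\<lambda>i. {i}) ` {..<d}) \<subseteq> {x\<in>carrier ?G. f {} \<otimes>\<^bsub>?G\<^esub> ?\<phi> x = f x}"
    using extend_basis_singleton[of ?F, OF F] by (auto simp: subset_group_def)
  then have "card (insert {} ((\<lambda>i. {i}) ` {..<d})) \<le> card {x\<in>carrier ?G. f {} \<otimes>\<^bsub>?G\<^esub> ?\<phi> x = f x}"
    using finite_subset_group by (intro card_mono) auto
  also have "\<dots> \<le> affapp ?G" by (rule le[OF f0 extend_basis_hom])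
  finally show ?thesis by (subst (asm) card_insert_disjoint) (auto simp: card_image)
qed

section \<open>An algebra over the field with three elements\<close>

type_synonym vec = "int \<times> int \<times> int"

text \<open>The cross product with its coordinates shifted cyclically.\<close>

fun bracket :: "vec \<Rightarrow> vec \<Rightarrow> vec" where
  "bracket (x1, x2, x3) (y1, y2, y3) = (x1 * y2 - x2 * y1, x2 * y3 - x3 * y2, x3 * y1 - x1 * y3)"

fun scale :: "int \<Rightarrow> vec \<Rightarrow> vec" where
  "scale c (x1, x2, x3) = (c * x1, c * x2, c * x3)"

fun vmod :: "vec \<Rightarrow> int \<Rightarrow> vec" where
  "vmod (x1, x2, x3) n = (x1 mod n, x2 mod n, x3 mod n)"

text \<open>The group law before reduction. Over the integers, identities are plain algebra and are
  reduced modulo the required number afterwards.\<close>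

definition twist :: "int \<Rightarrow> vec \<Rightarrow> vec \<Rightarrow> vec" where
  "twist m x y = x + y + scale m (bracket x y)"

text \<open>Lets a congruence be proved by displaying the multiple of \<open>n\<close> by which the
  two vectors differ.\<close>

lemma vmod_eq_iff: "vmod x n = vmod y n \<longleftrightarrow> (\<exists>w. x = y + scale n w)"
proof (cases x; cases y)
  fix x1 x2 x3 y1 y2 y3
  assume xy: "x = (x1, x2, x3)" "y = (y1, y2, y3)"
  have "(a mod n = b mod n) \<longleftrightarrow> (\<exists>k. a = b + n * k)" for a b :: int
    by (metis mod_mult_self2 mod_eqE add.commute)
  then show ?thesis by (auto simp: xy plus_prod_def)
qed

lemma vmod_vmod [simp]: "vmod (vmod x n) n = vmod x n"
  by (cases x) simp

lemma vmod_vmod_cancel: "d dvd n \<Longrightarrow> vmod (vmod x n) d = vmod x d"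
  by (cases x) (simp add: mod_mod_cancel)

text \<open>Modulo 3 the number 2 is its own inverse; the witness arises from doubling the equation
  and subtracting 3x.\<close>

lemma vmod_scale_2_cancel:
  assumes "vmod (scale 2 x) 3 = vmod (scale 2 y) 3"
  shows "vmod x 3 = vmod y 3"
proof -
  obtain w where w: "scale 2 x = scale 2 y + scale 3 w"
    using assms unfolding vmod_eq_iff by blast
  then have "x = y + scale 3 (y + scale 2 w - x)"
    by (cases x; cases y; cases w) (simp add: algebra_simps)
  then show ?thesis unfolding vmod_eq_iff by blast
qed

lemma vmod_twist_cong:
  assumes "vmod x n = vmod x' n" "vmod y n = vmod y' n"
  shows "vmod (twist m x y) n = vmod (twist m x' y') n"
proof -
  obtain u v where uv: "x = x' + scale n u" "y = y' + scale n v"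
    using assms unfolding vmod_eq_iff by blast
  have "twist m x y = twist m x' y' + scale n (u + v
      + scale m (bracket u y' + bracket x' v + scale n (bracket u v)))"
    unfolding uv by (cases x'; cases y'; cases u; cases v) (simp add: twist_def algebra_simps)
  then show ?thesis unfolding vmod_eq_iff by blast
qed

lemma vmod_twist: "vmod (twist m (vmod x n) (vmod y n)) n = vmod (twist m x y) n"
  by (rule vmod_twist_cong) simp_all

text \<open>By bilinearity the terms linear in m = 3t agree. The remaining ones carry the factor m^2
  = 9t * t and vanish modulo 9t.\<close>

lemma vmod_twist_assoc:
  "vmod (twist (3 * t) (twist (3 * t) x y) z) (9 * t) = vmod (twist (3 * t) x (twist (3 * t) y z)) (9 * t)"
proof -
  have "twist (3 * t) (twist (3 * t) x y) z = twist (3 * t) x (twist (3 * t) y z)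
      + scale (9 * t) (scale t (bracket (bracket x y) z - bracket x (bracket y z)))"
    by (cases x; cases y; cases z) (simp add: twist_def algebra_simps)
  then show ?thesis unfolding vmod_eq_iff by blast
qed

text \<open>Here a, b, c are the images of the basis vectors under an endomorphism of the algebra
  over F_3. The condition [a, b] = a precedes the quantifiers for c, so that c need only be searched
  for pairs that already satisfy it.\<close>

lemma algebra_endomorphisms_mod_3:
  "\<forall>b1\<in>{0,1,2::int}. \<forall>b2\<in>{0,1,2}. \<forall>b3\<in>{0,1,2}. \<forall>a1\<in>{0,1,2}. \<forall>a2\<in>{0,1,2}. \<forall>a3\<in>{0,1,2}.
    a1 = (a1*b2 - a2*b1) mod 3 \<longrightarrow> a2 = (a2*b3 - a3*b2) mod 3 \<longrightarrow> a3 = (a3*b1 - a1*b3) mod 3 \<longrightarrow>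
    (\<forall>c1\<in>{0,1,2}. \<forall>c2\<in>{0,1,2}. \<forall>c3\<in>{0,1,2}.
      b1 = (b1*c2 - b2*c1) mod 3 \<longrightarrow> b2 = (b2*c3 - b3*c2) mod 3 \<longrightarrow> b3 = (b3*c1 - b1*c3) mod 3 \<longrightarrow>
      c1 = (c1*a2 - c2*a1) mod 3 \<longrightarrow> c2 = (c2*a3 - c3*a2) mod 3 \<longrightarrow> c3 = (c3*a1 - c1*a3) mod 3 \<longrightarrow>
      ((a1,a2,a3),(b1,b2,b3),(c1,c2,c3)) \<in>
        {((0,0,0),(0,0,0),(0,0,0)), ((1,0,0),(0,1,0),(0,0,1)),
         ((0,1,0),(0,0,1),(1,0,0)), ((0,0,1),(1,0,0),(0,1,0))})"
  by code_simp

lemma algebra_endomorphism_cases: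
  assumes "vmod a 3 = vmod (bracket a b) 3" "vmod b 3 = vmod (bracket b c) 3" "vmod c 3 = vmod (bracket c a) 3"
  shows "(vmod a 3, vmod b 3, vmod c 3) \<in>
    {((0,0,0),(0,0,0),(0,0,0)), ((1,0,0),(0,1,0),(0,0,1)),
     ((0,1,0),(0,0,1),(1,0,0)), ((0,0,1),(1,0,0),(0,1,0))}"
proof -
  obtain a1 a2 a3 b1 b2 b3 c1 c2 c3
    where abc: "a = (a1, a2, a3)" "b = (b1, b2, b3)" "c = (c1, c2, c3)"
    by (cases a; cases b; cases c)
  have r: "x mod 3 \<in> {0, 1, 2}" for x :: int by auto
  have mm: "((x mod 3) * (y mod 3) - (z mod 3) * (w mod 3)) mod 3 = (x * y - z * w) mod 3" for x y z w :: int
    by (intro mod_diff_cong mod_mult_cong) simp_all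
  have eqs:
    "a1 mod 3 = ((a1 mod 3) * (b2 mod 3) - (a2 mod 3) * (b1 mod 3)) mod 3"
    "a2 mod 3 = ((a2 mod 3) * (b3 mod 3) - (a3 mod 3) * (b2 mod 3)) mod 3"
    "a3 mod 3 = ((a3 mod 3) * (b1 mod 3) - (a1 mod 3) * (b3 mod 3)) mod 3"
    "b1 mod 3 = ((b1 mod 3) * (c2 mod 3) - (b2 mod 3) * (c1 mod 3)) mod 3"
    "b2 mod 3 = ((b2 mod 3) * (c3 mod 3) - (b3 mod 3) * (c2 mod 3)) mod 3"
    "b3 mod 3 = ((b3 mod 3) * (c1 mod 3) - (b1 mod 3) * (c3 mod 3)) mod 3"
    "c1 mod 3 = ((c1 mod 3) * (a2 mod 3) - (c2 mod 3) * (a1 mod 3)) mod 3"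
    "c2 mod 3 = ((c2 mod 3) * (a3 mod 3) - (c3 mod 3) * (a2 mod 3)) mod 3"
    "c3 mod 3 = ((c3 mod 3) * (a1 mod 3) - (c1 mod 3) * (a3 mod 3)) mod 3"
    using assms unfolding abc vmod.simps bracket.simps mm prod.inject by blast+
  show ?thesis
    unfolding abc vmod.simps
    by (rule algebra_endomorphisms_mod_3[THEN bspec, OF r, THEN bspec, OF r, THEN bspec, OF r,
      THEN bspec, OF r, THEN bspec, OF r, THEN bspec, OF r,
      THEN mp, OF eqs(1), THEN mp, OF eqs(2), THEN mp, OF eqs(3),
      THEN bspec, OF r, THEN bspec, OF r, THEN bspec, OF r,
      THEN mp, OF eqs(4), THEN mp, OF eqs(5), THEN mp, OF eqs(6),
      THEN mp, OF eqs(7), THEN mp, OF eqs(8), THEN mp, OF eqs(9)])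
qed

text \<open>The zero map forces w = 0 at once. The other three maps have cube 1, so eigenvalue -1
  would give w = -w, and 2 is invertible modulo 3. The proof checks this on residues.\<close>

lemma eigenvalue_minus_one_imp_zero:
  assumes eig: "vmod (scale w1 a + scale w2 b + scale w3 c) 3 = vmod (- (w1, w2, w3)) 3"
    and endo: "vmod a 3 = vmod (bracket a b) 3" "vmod b 3 = vmod (bracket b c) 3" "vmod c 3 = vmod (bracket c a) 3"
  shows "vmod (w1, w2, w3) 3 = 0"
proof -
  obtain a1 a2 a3 b1 b2 b3 c1 c2 c3
    where abc: "a = (a1, a2, a3)" "b = (b1, b2, b3)" "c = (c1, c2, c3)"
    by (cases a; cases b; cases c)
  define p q r where "p = w1 mod 3" and "q = w2 mod 3" and "r = w3 mod 3"
  have pqr: "p \<in> {0, 1, 2}" "q \<in> {0, 1, 2}" "r \<in> {0, 1, 2}" by (auto simp: p_def q_def r_def)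
  have e: "(w1 * x + w2 * y + w3 * z) mod 3 = (p * (x mod 3) + q * (y mod 3) + r * (z mod 3)) mod 3"
    for x y z unfolding p_def q_def r_def by (intro mod_add_cong mod_mult_cong) simp_all
  have eqs: "(p * (a1 mod 3) + q * (b1 mod 3) + r * (c1 mod 3)) mod 3 = (- p) mod 3"
    "(p * (a2 mod 3) + q * (b2 mod 3) + r * (c2 mod 3)) mod 3 = (- q) mod 3"
    "(p * (a3 mod 3) + q * (b3 mod 3) + r * (c3 mod 3)) mod 3 = (- r) mod 3"
    unfolding e[symmetric] using eig by (simp_all add: abc p_def q_def r_def mod_minus_eq)
  consider
      "vmod a 3 = (0, 0, 0)" "vmod b 3 = (0, 0, 0)" "vmod c 3 = (0, 0, 0)"
    | "vmod a 3 = (1, 0, 0)" "vmod b 3 = (0, 1, 0)" "vmod c 3 = (0, 0, 1)"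
    | "vmod a 3 = (0, 1, 0)" "vmod b 3 = (0, 0, 1)" "vmod c 3 = (1, 0, 0)"
    | "vmod a 3 = (0, 0, 1)" "vmod b 3 = (1, 0, 0)" "vmod c 3 = (0, 1, 0)"
    using algebra_endomorphism_cases[OF endo] by blast
  \<comment> \<open>The four disjuncts belong to the zero map, the identity and the two nontrivial
    cyclic shifts.\<close>
  then have "(- p) mod 3 = 0 \<and> (- q) mod 3 = 0 \<and> (- r) mod 3 = 0 \<or>
    (- p) mod 3 = p mod 3 \<and> (- q) mod 3 = q mod 3 \<and> (- r) mod 3 = r mod 3 \<or>
    (- p) mod 3 = r mod 3 \<and> (- q) mod 3 = p mod 3 \<and> (- r) mod 3 = q mod 3 \<or>
    (- p) mod 3 = q mod 3 \<and> (- q) mod 3 = r mod 3 \<and> (- r) mod 3 = p mod 3"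
    unfolding eqs[symmetric] by cases (simp_all add: abc)
  then have "p = 0 \<and> q = 0 \<and> r = 0"
    using pqr unfolding insert_iff empty_iff by (elim disjE) simp_all
  then show ?thesis by (simp add: p_def q_def r_def zero_prod_def)
qed

section \<open>Groups without endomorphisms inverting an element\<close>

text \<open>For t = 3^j this is (Z/3^(j+2))^3 with the product twisted by 3^(j+1), on canonical
  representatives.\<close>

definition twisted_group :: "nat \<Rightarrow> vec monoid" where
  "twisted_group t =
    \<lparr>carrier = {0..<9 * int t} \<times> {0..<9 * int t} \<times> {0..<9 * int t},
     monoid.mult = (\<lambda>x y. vmod (twist (3 * int t) x y) (9 * int t)), one = (0, 0, 0)\<rparr>"

locale twisted =
  fixes t :: nat
  assumes t_pos: "0 < t"
begin

abbreviation "m \<equiv> 3 * int t"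
abbreviation "N \<equiv> 9 * int t"
abbreviation "G \<equiv> twisted_group t"

lemma vmod_in_carrier [simp]: "vmod x N \<in> carrier G"
  using t_pos by (cases x) (auto simp: twisted_group_def)

lemma vmod_carrier: "x \<in> carrier G \<Longrightarrow> vmod x N = x"
  by (cases x) (auto simp: twisted_group_def)

lemma mult_vmod: "vmod x N \<otimes>\<^bsub>G\<^esub> vmod y N = vmod (twist m x y) N"
  by (simp add: twisted_group_def vmod_twist)

lemma mult_G: "x \<otimes>\<^bsub>G\<^esub> y = vmod (twist m x y) N"
  by (simp add: twisted_group_def)

lemma one_G: "\<one>\<^bsub>G\<^esub> = vmod 0 N"
  by (simp add: twisted_group_def zero_prod_def)

lemma twist_0 [simp]: "twist k 0 x = x" "twist k x 0 = x"
  by (cases x; simp add: twist_def zero_prod_def)+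

text \<open>The bracket is alternating, so inverses in the group are the additive ones.\<close>

lemma twist_minus [simp]: "twist k (- x) x = 0"
  by (cases x) (simp add: twist_def zero_prod_def)

lemma group_G: "group G"
proof (rule groupI)
  fix x y z assume "x \<in> carrier G" "y \<in> carrier G" "z \<in> carrier G"
  then have *: "x = vmod x N" "y = vmod y N" "z = vmod z N" by (simp_all only: vmod_carrier)
  show "x \<otimes>\<^bsub>G\<^esub> y \<otimes>\<^bsub>G\<^esub> z = x \<otimes>\<^bsub>G\<^esub> (y \<otimes>\<^bsub>G\<^esub> z)"
    by (subst (1 2) *(1), subst (1 2) *(2), subst (1 2) *(3))
       (simp only: mult_vmod vmod_twist_assoc)
next
  fix x assume "x \<in> carrier G"
  then have "vmod (- x) N \<otimes>\<^bsub>G\<^esub> x = \<one>\<^bsub>G\<^esub>"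
    using mult_vmod[of "- x" x] by (simp only: vmod_carrier one_G twist_minus)
  then show "\<exists>y\<in>carrier G. y \<otimes>\<^bsub>G\<^esub> x = \<one>\<^bsub>G\<^esub>" using vmod_in_carrier by blast
next
  fix x assume "x \<in> carrier G"
  then show "\<one>\<^bsub>G\<^esub> \<otimes>\<^bsub>G\<^esub> x = x"
    using mult_vmod[of 0 x] by (simp only: vmod_carrier one_G twist_0)
qed (auto simp: mult_G one_G)

lemma finite_G: "finite (carrier G)"
  by (simp add: twisted_group_def)

lemma order_G: "order G = (9 * t) ^ 3"
proof -
  have "nat (9 * int t) = 9 * t" by linarith
  then show ?thesis
    by (simp add: order_def twisted_group_def card_cartesian_product power3_eq_cube del: nat_mult_distrib)
qed

lemma inv_G:
  assumes "x \<in> carrier G"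
  shows "inv\<^bsub>G\<^esub> x = vmod (- x) N"
proof -
  interpret group G by (rule group_G)
  have "vmod (- x) N \<otimes>\<^bsub>G\<^esub> x = \<one>\<^bsub>G\<^esub>"
    using mult_vmod[of "- x" x] assms by (simp only: vmod_carrier one_G twist_minus)
  then show ?thesis using assms by (intro inv_equality) auto
qed

section \<open>Reduction of an endomorphism modulo 3\<close>

context
  fixes \<phi> assumes hom: "\<phi> \<in> hom G G"
begin

text \<open>Extends the endomorphism to all integer vectors, so that it can be applied to integer
  identities without tracking representatives.\<close>

definition lift :: "vec \<Rightarrow> vec" where
  "lift x = \<phi> (vmod x N)"

lemma lift_cong: "vmod x N = vmod y N \<Longrightarrow> lift x = lift y"
  by (simp add: lift_def)

lemma lift_twist: "lift (twist m x y) = vmod (twist m (lift x) (lift y)) N"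
proof -
  have "\<phi> (vmod x N \<otimes>\<^bsub>G\<^esub> vmod y N) = \<phi> (vmod x N) \<otimes>\<^bsub>G\<^esub> \<phi> (vmod y N)"
    by (rule hom_mult[OF hom vmod_in_carrier vmod_in_carrier])
  then show ?thesis unfolding mult_vmod by (simp only: lift_def mult_G)
qed

lemma lift_0: "lift 0 = 0"
proof -
  interpret group_hom G G \<phi> using hom group_G by (simp add: group_hom_def group_hom_axioms_def)
  show ?thesis using hom_one by (simp add: one_G lift_def zero_prod_def)
qed

text \<open>As [x, x] = 0, the n-th power of x in the group is its multiple nx, and homomorphisms
  preserve powers.\<close>

lemma lift_scale: "lift (scale (int n) x) = vmod (scale (int n) (lift x)) N"
proof (induction n)
  case 0
  have "scale 0 x = 0" "scale 0 (lift x) = 0" by (cases x; cases "lift x"; simp add: zero_prod_def)+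
  then show ?case using lift_0 by (simp add: zero_prod_def)
next
  case (Suc n)
  have *: "scale (int (Suc n)) y = twist m (scale (int n) y) y" for y
    by (cases y) (simp add: twist_def algebra_simps)
  have "lift (scale (int (Suc n)) x) = vmod (twist m (vmod (scale (int n) (lift x)) N) (lift x)) N"
    by (simp only: * lift_twist Suc)
  also have "\<dots> = vmod (scale (int (Suc n)) (lift x)) N"
    unfolding * by (rule vmod_twist_cong) simp_all
  finally show ?case .
qed

lemma lift_scale_mod_3: "vmod (lift (scale (int n) x)) 3 = vmod (scale (int n) (lift x)) 3"
  by (simp add: lift_scale vmod_vmod_cancel)

lemma lift_scale_m: "lift (scale m x) = vmod (scale m (lift x)) N"
  using lift_scale[of "3 * t" x] by (simp del: vmod.simps scale.simps)

text \<open>Modulo N, the sum x + y is the group product of x, y and m w with w = -[x, y], because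
  m^2 is a multiple of N. The endomorphism maps m w to m times a vector, which disappears modulo
  3.\<close>

lemma lift_add_mod_3: "vmod (lift (x + y)) 3 = vmod (lift x + lift y) 3"
proof -
  define w where "w = - bracket x y"
  have "twist m (twist m x y) (scale m w) = x + y + scale N (scale (- int t) (bracket (twist m x y) (bracket x y)))"
    unfolding w_def by (cases x; cases y) (simp add: twist_def algebra_simps)
  then have "vmod (x + y) N = vmod (twist m (twist m x y) (scale m w)) N"
    unfolding vmod_eq_iff[of "twist m (twist m x y) (scale m w)" N "x + y", symmetric]
    by (metis vmod_eq_iff)
  then have "lift (x + y) = vmod (twist m (lift (twist m x y)) (lift (scale m w))) N"
    using lift_cong lift_twist by metis
  also have "\<dots> = vmod (twist m (twist m (lift x) (lift y)) (scale m (lift w))) N"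
    unfolding lift_twist lift_scale_m by (rule vmod_twist_cong) simp_all
  finally have "vmod (lift (x + y)) 3 = vmod (twist m (twist m (lift x) (lift y)) (scale m (lift w))) 3"
    by (simp add: vmod_vmod_cancel)
  also have "\<dots> = vmod (lift x + lift y) 3"
  proof -
    obtain X Y W where XYW: "lift x = X" "lift y = Y" "lift w = W" by blast
    have "twist m (twist m X Y) (scale m W) = X + Y + scale 3 (scale (int t)
      (bracket X Y + W + bracket (twist m X Y) (scale m W)))"
      by (cases X; cases Y; cases W) (simp add: twist_def algebra_simps)
    then show ?thesis unfolding XYW vmod_eq_iff by blast
  qed
  finally show ?thesis .
qed

text \<open>Modulo N, the product of x and y is the product of y and x times 2m[x, y]. Applying the
  endomorphism and comparing gives the claim multiplied by 2m modulo N = 3m; then m and 2 are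
  cancelled.\<close>

lemma lift_bracket_mod_3: "vmod (lift (bracket x y)) 3 = vmod (bracket (lift x) (lift y)) 3"
proof -
  obtain X Y Z where XY: "lift x = X" "lift y = Y" and Z: "lift (scale 2 (bracket x y)) = Z" by blast
  have "twist m (twist m y x) (scale m (scale 2 (bracket x y)))
      = twist m x y + scale N (scale (2 * int t) (bracket (twist m y x) (bracket x y)))"
    by (cases x; cases y) (simp add: twist_def algebra_simps)
  then have "vmod (twist m (twist m y x) (scale m (scale 2 (bracket x y)))) N = vmod (twist m x y) N"
    unfolding vmod_eq_iff by blast
  then have "lift (twist m x y) = lift (twist m (twist m y x) (scale m (scale 2 (bracket x y))))"
    using lift_cong by metis
  also have "\<dots> = vmod (twist m (lift (twist m y x)) (lift (scale m (scale 2 (bracket x y))))) N"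
    by (rule lift_twist)
  also have "\<dots> = vmod (twist m (twist m Y X) (scale m Z)) N"
    unfolding lift_twist lift_scale_m XY Z by (rule vmod_twist_cong) simp_all
  finally have "vmod (twist m X Y) N = vmod (twist m (twist m Y X) (scale m Z)) N"
    by (simp add: lift_twist XY)
  then obtain w where w: "twist m X Y = twist m (twist m Y X) (scale m Z) + scale N w"
    unfolding vmod_eq_iff by blast
  \<comment> \<open>All terms are multiples of m: the corrections have the factors m^2 = m * 3t and
    N = m * 3, which leave multiples of 3 after division by m.\<close>
  have "scale m (scale 2 (bracket X Y)) = scale m (Z + scale 3 (scale (int t) (bracket (twist m Y X) Z) + w))"
    using w by (cases X; cases Y; cases Z; cases w) (simp add: twist_def algebra_simps)
  then have "scale 2 (bracket X Y) = Z + scale 3 (scale (int t) (bracket (twist m Y X) Z) + w)"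
    using t_pos by (cases "scale 2 (bracket X Y)"; cases "Z + scale 3 (scale (int t) (bracket (twist m Y X) Z) + w)") auto
  then have "vmod (scale 2 (bracket X Y)) 3 = vmod Z 3"
    unfolding vmod_eq_iff by blast
  also have "\<dots> = vmod (scale 2 (lift (bracket x y))) 3"
    using lift_scale_mod_3[of 2 "bracket x y"] Z by simp
  finally have "vmod (bracket X Y) 3 = vmod (lift (bracket x y)) 3"
    by (rule vmod_scale_2_cancel)
  then show ?thesis by (simp add: XY)
qed

text \<open>Write u = d w with w nonzero modulo 3. From d phi(w) = -d w modulo N, with N a power of
  3 that does not divide d, it follows that phi(w) = -w modulo 3. So w would be an eigenvector for
  -1 of an endomorphism of the algebra.\<close>

lemma hom_fixes_no_inverse:
  assumes u: "u \<in> carrier G" "u \<noteq> \<one>\<^bsub>G\<^esub>" and \<phi>u: "\<phi> u = inv\<^bsub>G\<^esub> u" and t: "3 * t = 3 ^ k"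
  shows False
proof -
  obtain u1 u2 u3 where u_eq: "u = (u1, u2, u3)" by (cases u)
  have range: "0 \<le> u1" "u1 < N" "0 \<le> u2" "u2 < N" "0 \<le> u3" "u3 < N"
    using u(1) by (auto simp: u_eq twisted_group_def)
  \<comment> \<open>Dividing by the full gcd ensures that 3 does not divide all coordinates of the
    quotient.\<close>
  define d where "d = gcd u1 (gcd u2 u3)"
  have nz: "u1 \<noteq> 0 \<or> u2 \<noteq> 0 \<or> u3 \<noteq> 0"
    using u(2) by (auto simp: u_eq twisted_group_def)
  then have d: "0 < d" by (auto simp: d_def)
  have dvd: "d dvd u1" "d dvd u2" "d dvd u3" unfolding d_def by (auto intro: dvd_trans)
  then obtain w1 w2 w3 where w: "u1 = d * w1" "u2 = d * w2" "u3 = d * w3"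
    by (auto elim!: dvdE)
  define w where "w = (w1, w2, w3)"
  have uw: "u = scale d w" by (simp add: u_eq w w_def)
  have w_nonneg: "0 \<le> w1" "0 \<le> w2" "0 \<le> w3"
    using range d by (auto simp: w zero_le_mult_iff)
  have w_mod: "\<not> (3 dvd w1 \<and> 3 dvd w2 \<and> 3 dvd w3)"
  proof
    assume "3 dvd w1 \<and> 3 dvd w2 \<and> 3 dvd w3"
    then have "d * 3 dvd u1" "d * 3 dvd u2" "d * 3 dvd u3" by (auto simp: w)
    then have "d * 3 dvd d" by (metis d_def gcd_greatest)
    then show False using d by (auto dest: zdvd_imp_le)
  qed
  have d_lt: "d < N"
    using nz range d dvd by (metis zdvd_imp_le le_less_trans order_le_less)
  have "lift u = vmod (scale d (lift w)) N"
    using lift_scale[of "nat d" w] d uw by simp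
  moreover have "lift u = vmod (- u) N"
    using \<phi>u inv_G[OF u(1)] vmod_carrier[OF u(1)] by (simp add: lift_def)
  ultimately obtain v where v: "scale d (lift w) = - u + scale N v"
    using vmod_eq_iff by metis
  have not_N: "\<not> N dvd d" using d d_lt by (auto dest: zdvd_imp_le)
  have "int (3 * t) = int (3 ^ k)" using t by (rule arg_cong)
  then have N: "N = 3 ^ Suc k" by simp
  \<comment> \<open>If 3 did not divide a, then a would be coprime to the power N of 3, and N would
    divide d, although 0 < d < N.\<close>
  have three: "3 dvd a" if "N dvd d * a" for a :: int
  proof (rule ccontr)
    assume "\<not> 3 dvd a"
    then have "coprime 3 a" by (simp add: prime_imp_coprime)
    then have "coprime N a" unfolding N by simp
    then show False using that not_N coprime_dvd_mult_left_iff by blast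
  qed
  have lift_w: "vmod (lift w) 3 = vmod (- w) 3"
  proof -
    obtain l1 l2 l3 where l: "lift w = (l1, l2, l3)" by (cases "lift w")
    obtain v1 v2 v3 where v': "v = (v1, v2, v3)" by (cases v)
    have "d * (l1 + w1) = N * v1" "d * (l2 + w2) = N * v2" "d * (l3 + w3) = N * v3"
      using v unfolding l unfolding v' uw unfolding w_def by (simp_all add: algebra_simps)
    then have "3 dvd l1 + w1" "3 dvd l2 + w2" "3 dvd l3 + w3"
      by (auto intro!: three)
    then show ?thesis unfolding l unfolding w_def by (simp add: mod_eq_dvd_iff)
  qed
  let ?e1 = "(1, 0, 0) :: vec" and ?e2 = "(0, 1, 0) :: vec" and ?e3 = "(0, 0, 1) :: vec"
  have w_sum: "w = scale w1 ?e1 + scale w2 ?e2 + scale w3 ?e3" by (simp add: w_def)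
  have vmod_add_cong: "vmod (x + y) 3 = vmod (x' + y') 3"
    if "vmod x 3 = vmod x' 3" "vmod y 3 = vmod y' 3" for x y x' y' :: vec
    using that by (cases x; cases y; cases x'; cases y') (simp, metis mod_add_cong)
  \<comment> \<open>\<open>lift_scale\<close> concerns natural multiples, that is powers in the
    group; the coordinates of w are nonnegative because those of u are.\<close>
  have lift_scale': "vmod (lift (scale c x)) 3 = vmod (scale c (lift x)) 3" if "0 \<le> c" for c x
    using lift_scale_mod_3[of "nat c" x] that by simp
  have "vmod (lift w) 3 = vmod (scale w1 (lift ?e1) + scale w2 (lift ?e2) + scale w3 (lift ?e3)) 3"
  proof -
    have "vmod (lift w) 3 = vmod (lift (scale w1 ?e1 + scale w2 ?e2) + lift (scale w3 ?e3)) 3"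
      unfolding w_sum by (rule lift_add_mod_3)
    also have "\<dots> = vmod (lift (scale w1 ?e1) + lift (scale w2 ?e2) + lift (scale w3 ?e3)) 3"
      by (rule vmod_add_cong[OF lift_add_mod_3 refl])
    also have "\<dots> = vmod (scale w1 (lift ?e1) + scale w2 (lift ?e2) + scale w3 (lift ?e3)) 3"
      using w_nonneg by (intro vmod_add_cong lift_scale')
    finally show ?thesis .
  qed
  then have "vmod (scale w1 (lift ?e1) + scale w2 (lift ?e2) + scale w3 (lift ?e3)) 3 = vmod (- w) 3"
    using lift_w by simp
  \<comment> \<open>The relations [e1, e2] = e1, [e2, e3] = e2 and [e3, e1] = e3 pass to the images
    modulo 3.\<close>
  moreover have "vmod (lift ?e1) 3 = vmod (bracket (lift ?e1) (lift ?e2)) 3"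
    "vmod (lift ?e2) 3 = vmod (bracket (lift ?e2) (lift ?e3)) 3"
    "vmod (lift ?e3) 3 = vmod (bracket (lift ?e3) (lift ?e1)) 3"
    using lift_bracket_mod_3[of ?e1 ?e2] lift_bracket_mod_3[of ?e2 ?e3] lift_bracket_mod_3[of ?e3 ?e1]
    by simp_all
  ultimately have "vmod w 3 = 0"
    unfolding w_def by (intro eigenvalue_minus_one_imp_zero)
  then show False using w_mod by (auto simp: w_def zero_prod_def)
qed

end

end

section \<open>Minimal approximability when no element is inverted, and the resulting
  examples\<close>

lemma (in group) endapp_0_affapp_1_if_no_inverse:
  assumes fin: "finite (carrier G)" and nontrivial: "\<not> trivial_group G"
    and no_inv: "\<And>\<phi> u. \<phi> \<in> hom G G \<Longrightarrow> u \<in> carrier G \<Longrightarrow> u \<noteq> \<one> \<Longrightarrow> \<phi> u \<noteq> inv u"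
  shows "endapp G = 0" "affapp G = 1"
proof -
  obtain a where a: "a \<in> carrier G" "a \<noteq> \<one>"
    using nontrivial by (auto simp: trivial_group_def)
  \<comment> \<open>Inversion agrees with every endomorphism at the neutral element, so its value
    there is replaced by a nontrivial element.\<close>
  let ?f = "\<lambda>x. if x = \<one> then a else inv x"
  have card_0: "card {x\<in>carrier G. \<phi> x = ?f x} \<le> 0" if "\<phi> \<in> hom G G" for \<phi>
  proof -
    interpret group_hom G G \<phi> using that by unfold_locales
    have "{x\<in>carrier G. \<phi> x = ?f x} = {}" using a no_inv[OF that] by auto
    then show ?thesis by (simp only: card.empty)
  qed
  have "?f \<in> carrier G \<rightarrow> carrier G" using a by auto
  then have "endapp G \<le> 0"
    unfolding endapp_le_iff[OF is_group fin] by (intro bexI[of _ ?f] ballI card_0)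
  then show "endapp G = 0" by simp
  have "card {x\<in>carrier G. g \<otimes> \<phi> x = inv x} \<le> 1" if g: "g \<in> carrier G" and \<phi>: "\<phi> \<in> hom G G" for g \<phi>
  proof -
    interpret group_hom G G \<phi> using \<phi> by unfold_locales
    have "x = y" if x: "x \<in> carrier G" "g \<otimes> \<phi> x = inv x" and y: "y \<in> carrier G" "g \<otimes> \<phi> y = inv y" for x y
    proof (rule ccontr)
      assume "x \<noteq> y"
      define v where "v = inv x \<otimes> y"
      have v: "v \<in> carrier G" "y = x \<otimes> v" using x y by (simp_all add: v_def m_assoc[symmetric])
      have v1: "v \<noteq> \<one>" using \<open>x \<noteq> y\<close> v x by auto
      have cancel: "x \<otimes> (inv x \<otimes> z) = z" "inv x \<otimes> (x \<otimes> z) = z" if "z \<in> carrier G" for z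
        using that x(1) by (simp_all flip: m_assoc)
      \<comment> \<open>As y = x v and g phi(x) = x^-1, the agreement at y reads x^-1 phi(v) = y^-1
        = v^-1 x^-1; multiplying by x on the right exhibits v as inverted.\<close>
      have "inv x \<otimes> \<phi> v = g \<otimes> \<phi> y"
        using g x v by (simp add: m_assoc flip: x(2))
      then have "inv x \<otimes> \<phi> v \<otimes> x = inv v"
        using x y by (simp add: v_def inv_mult_group)
      moreover have "(\<lambda>z. inv x \<otimes> \<phi> z \<otimes> x) \<in> hom G G"
        using x(1) cancel by (intro homI) (simp_all add: m_assoc)
      ultimately show False using no_inv v(1) v1 by blast
    qed
    then have "card {x\<in>carrier G. g \<otimes> \<phi> x = inv x} \<le> Suc 0"
      using fin by (subst card_le_Suc0_iff_eq) auto
    then show ?thesis by simp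
  qed
  then have "affapp G \<le> 1"
    unfolding affapp_le_iff[OF is_group fin] by (intro bexI[of _ "\<lambda>x. inv x"]) auto
  then show "affapp G = 1" using affapp_ge_1[OF is_group fin] by simp
qed

lemma twisted_group_endapp_affapp:
  fixes j :: nat
  defines "G \<equiv> twisted_group (3 ^ j)"
  shows "group G" "finite (carrier G)" "j \<le> order G" "endapp G = 0" "affapp G = 1"
proof -
  interpret twisted "3 ^ j" by unfold_locales simp
  show grp: "group G" and fin: "finite (carrier G)" unfolding G_def by (rule group_G finite_G)+
  have "j < (3 :: nat) ^ j" by (rule power_gt_expt) simp
  also have "(3 :: nat) ^ j \<le> (9 * 3 ^ j) ^ 1" by simp
  also have "\<dots> \<le> (9 * 3 ^ j) ^ (3 :: nat)" by (rule power_increasing) simp_all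
  finally have "j < order G" unfolding G_def order_G .
  then show "j \<le> order G" by simp
  have "1 < 9 * (3 :: nat) ^ j" using one_le_power[of "3 :: nat" j] by linarith
  then have "1 < (9 * 3 ^ j :: nat) ^ 3" by (rule one_less_power) simp
  then have "\<not> trivial_group G"
    using order_G by (auto simp: trivial_group_def order_def G_def)
  moreover have "\<phi> u \<noteq> inv\<^bsub>G\<^esub> u" if "\<phi> \<in> hom G G" "u \<in> carrier G" "u \<noteq> \<one>\<^bsub>G\<^esub>" for \<phi> u
    \<comment> \<open>With t = 3^j the required power is 3t = 3^(j+1).\<close>
    using hom_fixes_no_inverse[of \<phi> u "Suc j"] that by (auto simp: G_def)
  ultimately show "endapp G = 0" "affapp G = 1"
    using group.endapp_0_affapp_1_if_no_inverse[OF grp fin] by blast+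
qed

section \<open>The approximability bounds\<close>

theorem theorem1p1p4:
  shows
    "((\<forall>G :: ('a, 'b) monoid_scheme. group G \<and> finite (carrier G) \<and> \<not> trivial_group G \<longrightarrow>
          0 \<le> real (endapp G) \<and>
          real (endapp G) \<le> (1 / ln 2 + 1 / ln (real (order G))) * (ln (real (order G)))\<^sup>2 \<and>
          1 \<le> real (affapp G) \<and>
          real (affapp G) \<le> (1 / ln 2 + 2 / ln (real (order G))) * (ln (real (order G)))\<^sup>2) \<and>
      (\<forall>G :: ('a, 'b) monoid_scheme. group G \<and> finite (carrier G) \<longrightarrow> endapp G \<le> affapp G) \<and>
      (\<lambda>G :: ('a, 'b) monoid_scheme. real (affapp G))
        \<in> O[large_finite_groups](\<lambda>G. (ln (real (order G)))\<^sup>2)) \<and>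
     ((\<exists>\<H> :: nat monoid set. infinite \<H> \<and> pairwise (\<lambda>H K. \<not> H \<cong> K) \<H> \<and>
          (\<forall>H\<in>\<H>. group H \<and> finite (carrier H) \<and>
             real (endapp H) \<ge> log 2 (real (order H)) \<and>
             real (affapp H) \<ge> log 2 (real (order H)) + 1)) \<and>
      Limsup large_finite_groups (\<lambda>G :: nat monoid. ereal (real (endapp G))) = \<infinity> \<and>
      Limsup large_finite_groups (\<lambda>G :: nat monoid. ereal (real (affapp G))) = \<infinity>) \<and>
     ((\<exists>\<G> :: nat monoid set. infinite \<G> \<and> pairwise (\<lambda>G K. \<not> G \<cong> K) \<G> \<and>
          (\<forall>G\<in>\<G>. group G \<and> finite (carrier G) \<and> endapp G = 0 \<and> affapp G = 1)) \<and>
      Liminf large_finite_groups (\<lambda>G :: nat monoid. ereal (real (endapp G))) = 0 \<and>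
      Liminf large_finite_groups (\<lambda>G :: nat monoid. ereal (real (affapp G))) = 1)"
proof (intro conjI)
  show "\<forall>G :: ('a, 'b) monoid_scheme. group G \<and> finite (carrier G) \<and> \<not> trivial_group G \<longrightarrow>
      0 \<le> real (endapp G) \<and>
      real (endapp G) \<le> (1 / ln 2 + 1 / ln (real (order G))) * (ln (real (order G)))\<^sup>2 \<and>
      1 \<le> real (affapp G) \<and>
      real (affapp G) \<le> (1 / ln 2 + 2 / ln (real (order G))) * (ln (real (order G)))\<^sup>2"
  proof (intro allI impI, elim conjE)
    fix G :: "('a, 'b) monoid_scheme"
    assume G: "group G" "finite (carrier G)" "\<not> trivial_group G"
    \<comment> \<open>This holds for all x: if \<open>ln x = 0\<close>, division by zero gives 0 and
      both sides vanish.\<close>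
    have eq: "(1 / ln 2 + c / ln x) * (ln x)\<^sup>2 = (ln x)\<^sup>2 / ln 2 + c * ln x" for x c :: real
      by (simp add: distrib_right power2_eq_square)
    show "0 \<le> real (endapp G) \<and>
        real (endapp G) \<le> (1 / ln 2 + 1 / ln (real (order G))) * (ln (real (order G)))\<^sup>2 \<and>
        1 \<le> real (affapp G) \<and>
        real (affapp G) \<le> (1 / ln 2 + 2 / ln (real (order G))) * (ln (real (order G)))\<^sup>2"
      unfolding eq using real_endapp_le[OF G] real_affapp_le[OF G] affapp_ge_1[OF G(1,2)] by simp
  qed
  show "\<forall>G :: ('a, 'b) monoid_scheme. group G \<and> finite (carrier G) \<longrightarrow> endapp G \<le> affapp G"
    by (simp add: endapp_le_affapp)
  show "(\<lambda>G :: ('a, 'b) monoid_scheme. real (affapp G))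
      \<in> O[large_finite_groups](\<lambda>G. (ln (real (order G)))\<^sup>2)"
    by (rule affapp_bigo)
next
  \<comment> \<open>The elementary abelian group of rank d, moved to a carrier of natural numbers;
    here log2 of the order is d.\<close>
  have large: "\<exists>H :: nat monoid. group H \<and> finite (carrier H) \<and> order H = 2 ^ d \<and>
      d \<le> endapp H \<and> d + 1 \<le> affapp H" for d
    using ex_nat_monoid[OF group_subset_group finite_subset_group, of d]
      endapp_subset_group_ge[of d] affapp_subset_group_ge[of d] by (auto simp: order_subset_group)
  have "\<exists>H :: nat monoid. (group H \<and> finite (carrier H) \<and>
        log 2 (real (order H)) \<le> real (endapp H) \<and> log 2 (real (order H)) + 1 \<le> real (affapp H)) \<and>
      n \<le> order H" for n
  proof -
    obtain H :: "nat monoid" where H: "group H" "finite (carrier H)" "order H = 2 ^ n"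
      "n \<le> endapp H" "n + 1 \<le> affapp H" using large by blast
    moreover have "log 2 (real (order H)) = real n" using H(3) by (simp add: log_nat_power)
    moreover have "n \<le> order H" using H(3) power_gt_expt[of 2 n] by simp
    ultimately show ?thesis by (intro exI[of _ H]) simp
  qed
  then show "\<exists>\<H> :: nat monoid set. infinite \<H> \<and> pairwise (\<lambda>H K. \<not> H \<cong> K) \<H> \<and>
      (\<forall>H\<in>\<H>. group H \<and> finite (carrier H) \<and>
         log 2 (real (order H)) \<le> real (endapp H) \<and>
         log 2 (real (order H)) + 1 \<le> real (affapp H))"
    by (rule infinite_class_of_orders)
  have "\<exists>H :: nat monoid. group H \<and> finite (carrier H) \<and> n \<le> order H \<and> n \<le> endapp H \<and> n \<le> affapp H" for n
    using large[of n] power_gt_expt[of 2 n] by fastforce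
  then show "Limsup large_finite_groups (\<lambda>G :: nat monoid. ereal (real (endapp G))) = \<infinity>"
    "Limsup large_finite_groups (\<lambda>G :: nat monoid. ereal (real (affapp G))) = \<infinity>"
    by (intro Limsup_large_finite_groups_eq_PInf; blast)+
next
  \<comment> \<open>Taking the parameter n itself suffices, as the order of the n-th twisted group
    is at least n.\<close>
  have small: "\<exists>H :: nat monoid. (group H \<and> finite (carrier H) \<and> endapp H = 0 \<and> affapp H = 1) \<and>
      n \<le> order H" for n
    using ex_nat_monoid[OF twisted_group_endapp_affapp(1,2)[of n]]
      twisted_group_endapp_affapp(3-5)[of n] by auto
  then show "\<exists>\<G> :: nat monoid set. infinite \<G> \<and> pairwise (\<lambda>G K. \<not> G \<cong> K) \<G> \<and>
      (\<forall>G\<in>\<G>. group G \<and> finite (carrier G) \<and> endapp G = 0 \<and> affapp G = 1)"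
    by (rule infinite_class_of_orders)
  have "Liminf large_finite_groups (\<lambda>G :: nat monoid. ereal (real (endapp G))) = ereal (real 0)"
    by (rule Liminf_large_finite_groups_eq) (simp, use small in blast)
  then show "Liminf large_finite_groups (\<lambda>G :: nat monoid. ereal (real (endapp G))) = 0" by simp
  have "Liminf large_finite_groups (\<lambda>G :: nat monoid. ereal (real (affapp G))) = ereal (real 1)"
    by (rule Liminf_large_finite_groups_eq) (rule affapp_ge_1, assumption+, use small in blast)
  then show "Liminf large_finite_groups (\<lambda>G :: nat monoid. ereal (real (affapp G))) = 1" by simp
qed

end
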